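(* Let $K$ be a field, let $d\le n$ be positive integers, and let $\mathcal{C}\neq \mathcal{C}_{n,d}$ be a $d$-uniform clutter on $[n]$. Let $e$ be a simplicial submaximal circuit of $\mathcal{C}$, and let $\mathcal{C}'=\mathcal{C}\setminus e=\{F\in\mathcal{C} : e\nsubseteq F\}$. Let $I=I(\bar{\mathcal{C}})$ and $J=I(\bar{\mathcal{C}'})$ be the corresponding ideals in $S=K[x_1,\dots,x_n]$. Then $\operatorname{reg}(I)=\operatorname{reg}(J)$.
   Context: $[n]=\{1,\dots,n\}$. A $d$-uniform clutter $\mathcal{C}$ on $[n]$ is a set of $d$-element subsets of $[n]$ (called circuits). $\mathcal{C}_{n,d}$ denotes the set of all $d$-subsets of $[n]$, and the complement of $\mathcal{C}$ is $\bar{\mathcal{C}}=\mathcal{C}_{n,d}\setminus\mathcal{C}$. For a clutter $\mathcal{D}$ on $[n]$, $I(\mathcal{D})=(\mathbf{x}_F : F\in\mathcal{D})\subset S=K[x_1,\dots,x_n]$, where $\mathbf{x}_F=\prod_{i\in F}x_i$, and $I(\varnothing)=0$. A subset $G\subset[n]$ is a clique in $\mathcal{C}$ if every $d$-subset of $G$ belongs to $\mathcal{C}$. A $(d-1)$-subset $e\subset[n]$ is a submaximal circuit of $\mathcal{C}$ if $e\subset F$ for some $F\in\mathcal{C}$. For such $e$, put $N[e]=e\cup\{c\in[n] : e\cup\{c\}\in\mathcal{C}\}$; $e$ is a simplicial submaximal circuit if $N[e]$ is a clique in $\mathcal{C}$. For a nonzero homogeneous ideal $I\subset S$, $\operatorname{reg}(I)=\sup\{j-i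 : \beta^S_{i,j}(I)\neq0\}$ is the Castelnuovo-Mumford regularity, where $\beta^S_{i,j}(I)$ are the graded Betti numbers of $I$ as an $S$-module. *)

theory Defs
  imports
    Complex_Main
    "HOL-Library.Cardinality"
    "HOL-Library.Poly_Mapping"
    "HOL-Library.Extended_Real"
begin

text \<open>
  The vertex set \<open>[n]\<close> is a finite type \<open>'n\<close> with \<open>CARD('n) = n\<close>, and \<open>S = K[x_1,...,x_n]\<close>
  is the type of finitely supported functions from exponent vectors to \<open>'k\<close>, with the
  convolution product of \<open>Poly_Mapping\<close>.
\<close>

type_synonym ('n, 'k) mpoly = "('n \<Rightarrow>\<^sub>0 nat) \<Rightarrow>\<^sub>0 'k"


section \<open>Clutters\<close>

definition uniform_clutter :: "nat \<Rightarrow> 'n set set \<Rightarrow> bool" where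
  "uniform_clutter d C \<longleftrightarrow> (\<forall>F\<in>C. card F = d)"

definition complete_clutter :: "nat \<Rightarrow> 'n set set" where
  "complete_clutter d = {F. card F = d}"

definition clutter_complement :: "nat \<Rightarrow> 'n set set \<Rightarrow> 'n set set" where
  "clutter_complement d C = complete_clutter d - C"

definition clique :: "nat \<Rightarrow> 'n set set \<Rightarrow> 'n set \<Rightarrow> bool" where
  "clique d C G \<longleftrightarrow> (\<forall>F. F \<subseteq> G \<and> card F = d \<longrightarrow> F \<in> C)"

definition submaximal_circuit :: "nat \<Rightarrow> 'n set set \<Rightarrow> 'n set \<Rightarrow> bool" where
  "submaximal_circuit d C e \<longleftrightarrow> card e = d - 1 \<and> (\<exists>F\<in>C. e \<subseteq> F)"

definition closed_nbhd :: "'n set set \<Rightarrow> 'n set \<Rightarrow> 'n set" where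
  "closed_nbhd C e = e \<union> {c. e \<union> {c} \<in> C}"

definition simplicial :: "nat \<Rightarrow> 'n set set \<Rightarrow> 'n set \<Rightarrow> bool" where
  "simplicial d C e \<longleftrightarrow> submaximal_circuit d C e \<and> clique d C (closed_nbhd C e)"

definition clutter_deletion :: "'n set set \<Rightarrow> 'n set \<Rightarrow> 'n set set" where
  "clutter_deletion C e = {F \<in> C. \<not> e \<subseteq> F}"

definition variable :: "'n \<Rightarrow> ('n, 'k::field) mpoly" where
  "variable i = Poly_Mapping.single (Poly_Mapping.single i 1) 1"

definition circuit_ideal :: "'n set set \<Rightarrow> ('n, 'k::field) mpoly set" where
  "circuit_ideal D = module.span (*) ((\<lambda>F. \<Prod>i\<in>F. variable i) ` D)"


section \<open>Graded free modules\<close>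

text \<open>
  All graded free modules are submodules of the free module on the basis
  \<open>\<nat> \<times> \<nat>\<close>, in which the basis element \<open>(j, k)\<close> has degree \<open>j\<close>. The function
  \<open>r :: nat \<Rightarrow> nat\<close> describes \<open>\<Oplus>\<^sub>j S(-j)\<^bsup>r j\<^esup>\<close>, the submodule spanned by
  the basis elements \<open>(j, k)\<close> with \<open>k < r j\<close>.
\<close>

type_synonym ('n, 'k) fmod = "(nat \<times> nat) \<Rightarrow>\<^sub>0 ('n, 'k) mpoly"

definition fscale :: "('n, 'k::field) mpoly \<Rightarrow> ('n, 'k) fmod \<Rightarrow> ('n, 'k) fmod" where
  "fscale p v = Poly_Mapping.map ((*) p) v"

lemma lookup_fscale:
  "Poly_Mapping.lookup (fscale p v) b = p * Poly_Mapping.lookup v b"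
  by (simp add: fscale_def Poly_Mapping.map.rep_eq when_def)

lemma module_fscale: "module fscale"
  by standard
    (auto intro!: poly_mapping_eqI simp: lookup_fscale lookup_add algebra_simps)

lemma module_mpoly: "module ((*) :: ('n, 'k::field) mpoly \<Rightarrow> _)"
  by standard (auto simp: algebra_simps)

definition free_module :: "(nat \<Rightarrow> nat) \<Rightarrow> ('n, 'k::field) fmod set" where
  "free_module r = {v. \<forall>(j, k) \<in> Poly_Mapping.keys v. k < r j}"

definition mono_degree :: "('n::finite \<Rightarrow>\<^sub>0 nat) \<Rightarrow> nat" where
  "mono_degree m = (\<Sum>i\<in>UNIV. Poly_Mapping.lookup m i)"

definition homogeneous :: "nat \<Rightarrow> ('n::finite, 'k::field) mpoly \<Rightarrow> bool" where
  "homogeneous t p \<longleftrightarrow> (\<forall>m \<in> Poly_Mapping.keys p. mono_degree m = t)"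

definition fhomogeneous :: "nat \<Rightarrow> ('n::finite, 'k::field) fmod \<Rightarrow> bool" where
  "fhomogeneous t v \<longleftrightarrow>
     (\<forall>(j, k) \<in> Poly_Mapping.keys v.
        \<forall>m \<in> Poly_Mapping.keys (Poly_Mapping.lookup v (j, k)). j + mono_degree m = t)"

text \<open>The graded maximal ideal \<open>(x_1,...,x_n)\<close> consists of the polynomials whose constant
  coefficient vanishes.\<close>

definition in_max_submodule :: "('n, 'k::field) fmod \<Rightarrow> bool" where
  "in_max_submodule v \<longleftrightarrow>
     (\<forall>b. Poly_Mapping.lookup (Poly_Mapping.lookup v b) 0 = 0)"


section \<open>Minimal graded free resolutions, Betti numbers and regularity\<close>

text \<open>
  In \<open>\<dots> \<rightarrow> F\<^sub>2 \<rightarrow> F\<^sub>1 \<rightarrow> F\<^sub>0 \<rightarrow> I \<rightarrow> 0\<close> the module \<open>F\<^sub>i\<close> is \<open>free_module (r i)\<close>, the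
  augmentation is \<open>aug\<close>, and \<open>\<delta> i\<close> is the map from \<open>F\<^bsub>i+1\<^esub>\<close> to \<open>F\<^sub>i\<close>. The maps are given on the
  ambient free module on all of \<open>\<nat> \<times> \<nat>\<close>, since every homomorphism defined on \<open>F\<^sub>i\<close>
  extends to it; only their restrictions to the \<open>F\<^sub>i\<close> are constrained. Finite generation of the
  \<open>F\<^sub>i\<close> is not required separately: it follows from minimality, because \<open>S\<close> is Noetherian.
\<close>

definition minimal_graded_free_resolution ::
  "('n::finite, 'k::field) mpoly set \<Rightarrow> (nat \<Rightarrow> nat \<Rightarrow> nat) \<Rightarrow>
   (('n, 'k) fmod \<Rightarrow> ('n, 'k) mpoly) \<Rightarrow> (nat \<Rightarrow> ('n, 'k) fmod \<Rightarrow> ('n, 'k) fmod) \<Rightarrow> bool"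
where
  "minimal_graded_free_resolution I r aug \<delta> \<longleftrightarrow>
     module_hom fscale (*) aug \<and>
     (\<forall>i. module_hom fscale fscale (\<delta> i)) \<and>
     (\<forall>t. \<forall>v \<in> free_module (r 0). fhomogeneous t v \<longrightarrow> homogeneous t (aug v)) \<and>
     (\<forall>i t. \<forall>v \<in> free_module (r (Suc i)). fhomogeneous t v \<longrightarrow> fhomogeneous t (\<delta> i v)) \<and>
     aug ` free_module (r 0) = I \<and>
     \<delta> 0 ` free_module (r 1) = {v \<in> free_module (r 0). aug v = 0} \<and>
     (\<forall>i. \<delta> (Suc i) ` free_module (r (Suc (Suc i))) =
            {v \<in> free_module (r (Suc i)). \<delta> i v = 0}) \<and>
     (\<forall>i. \<forall>v \<in> free_module (r (Suc i)). in_max_submodule (\<delta> i v))"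

text \<open>
  \<open>betti I i j\<close> is the multiplicity of \<open>S(-j)\<close> in the \<open>i\<close>-th module of a minimal graded
  free resolution of the homogeneous ideal \<open>I\<close>; it does not depend on the resolution chosen.
\<close>

definition betti :: "('n::finite, 'k::field) mpoly set \<Rightarrow> nat \<Rightarrow> nat \<Rightarrow> nat" where
  "betti I = (SOME r. \<exists>aug \<delta>. minimal_graded_free_resolution I r aug \<delta>)"

text \<open>The supremum is taken in the extended reals, so that it exists unconditionally.\<close>

definition regularity :: "('n::finite, 'k::field) mpoly set \<Rightarrow> ereal" where
  "regularity I = Sup {ereal (real j - real i) | i j. betti I i j \<noteq> 0}"

end

theory Submission
  imports Defs "HOL-Library.FuncSet"
begin

text \<open>
  Deleting \<open>e\<close> removes from \<open>C\<close> exactly the circuits \<open>e \<union> {c}\<close> with \<open>c\<close> in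
  \<open>A = N[e] - e\<close>, so \<open>J\<close> arises from \<open>I\<close> by adjoining the monomials \<open>x_e x_c\<close> one after the
  other. Consider a stage \<open>J_k\<close> of this process, let \<open>c\<close> be the next vertex, and let \<open>V\<close> consist
  of the vertices outside \<open>N[e]\<close> and of the elements of \<open>A\<close> treated before. The colon ideal
  \<open>J_k : x_e x_c\<close> is the prime ideal \<open>P_V = (x_v : v \<in> V)\<close>. Indeed, since \<open>N[e]\<close> is a clique,
  each circuit that generates \<open>I\<close> leaves \<open>N[e]\<close>, so all generators of \<open>J_k\<close> meet \<open>V\<close>, while
  \<open>V\<close> is disjoint from \<open>e \<union> {c}\<close>; conversely \<open>x_e x_v \<in> J_k\<close> for all \<open>v \<in> V\<close>. Hence
  \<open>J_(k+1) / J_k\<close> is \<open>S/P_V\<close> shifted by \<open>d\<close>, and a resolution of \<open>S/J_(k+1)\<close> is the mapping cone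
  of a lift of multiplication by \<open>x_e x_c\<close> from the resolution of \<open>S/P_V\<close> to that of \<open>S/J_k\<close>.

  The cone of an arbitrary lift need not be minimal: the degrees of the generators do not prevent unit
  entries. However \<open>x_e P_V \<subseteq> J_k\<close>, so multiplication by \<open>x_e\<close> alone lifts to a chain map
  \<open>\<phi>\<close>, and the lift \<open>x_c \<phi>\<close> of multiplication by \<open>x_e x_c\<close> has all its entries in the maximal
  ideal. With this choice the cone is minimal (\<open>mapping_cone_resolution\<close>,
  \<open>add_circuit_resolution\<close>). The resolution of \<open>S/P_V\<close> is linear, which the same mapping cone shows
  when the variables are adjoined one at a time (\<open>variable_ideal_linear_resolution\<close>). So passing
  from \<open>I\<close> to \<open>J\<close> only adds summands \<open>S(-i-d)\<close> in homological position \<open>i\<close>. They contribute the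
  value \<open>d\<close> to the regularity, and this value already occurs for both ideals because both have
  minimal generators of degree \<open>d\<close> (\<open>generator_rank_nonzero\<close>).

  To speak about the Betti numbers one needs that a minimal resolution exists
  (\<open>minimal_resolution_exists\<close>) and that the places where Betti numbers are nonzero do not depend on
  the resolution (\<open>betti_support_unique\<close>). The regularity is determined by these places alone.
\<close>

section \<open>Polynomials and graded free modules\<close>

abbreviation lookup where "lookup \<equiv> Poly_Mapping.lookup"
abbreviation keys where "keys \<equiv> Poly_Mapping.keys"

abbreviation basis_vec :: "nat \<times> nat \<Rightarrow> ('n, 'k::field) fmod" where
  "basis_vec b \<equiv> Poly_Mapping.single b 1"

abbreviation fhom :: "(('n, 'k::field) fmod \<Rightarrow> ('n, 'k) fmod) \<Rightarrow> bool" where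
  "fhom \<equiv> module_hom fscale fscale"

interpretation fm: module fscale
  by (rule module_fscale)

interpretation pm: module "(*) :: ('n, 'k::field) mpoly \<Rightarrow> _"
  by (rule module_mpoly)

lemma fhomI:
  assumes "\<And>u v. f (u + v) = f u + f v" and "\<And>p v. f (fscale p v) = fscale p (f v)"
  shows "fhom f"
  using assms by (unfold_locales) auto

lemma fhom_compose: "fhom f \<Longrightarrow> fhom g \<Longrightarrow> fhom (\<lambda>v. f (g v))"
  by (intro fhomI) (simp_all add: module_hom.add module_hom.scale)

lemma fhom_add: "fhom f \<Longrightarrow> fhom g \<Longrightarrow> fhom (\<lambda>v. f v + g v)"
  by (intro fhomI) (simp_all add: module_hom.add module_hom.scale fm.scale_right_distrib)

lemma fhom_diff: "fhom f \<Longrightarrow> fhom g \<Longrightarrow> fhom (\<lambda>v. f v - g v)"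
  by (intro fhomI) (simp_all add: module_hom.add module_hom.scale fm.scale_right_diff_distrib)

lemma fhom_fscale: "fhom (fscale p)"
  by (intro fhomI) (simp_all add: fm.scale_right_distrib mult.commute)

lemma fhom_zero: "fhom (\<lambda>v. 0)"
  by (intro fhomI) simp_all

lemma fhom_id: "fhom (\<lambda>v. v)"
  by (intro fhomI) simp_all

lemma mono_degree_add: "mono_degree (m + m') = mono_degree m + mono_degree m'"
  by (simp add: mono_degree_def lookup_add sum.distrib)

lemma mono_degree_eq_0_iff [simp]: "mono_degree m = 0 \<longleftrightarrow> m = 0"
  by (auto simp: mono_degree_def poly_mapping_eq_iff fun_eq_iff)

text \<open>
  Taking the constant coefficient is a ring homomorphism; this is what makes the vectors with entries
  in the maximal ideal stable under all homomorphisms.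
\<close>
lemma lookup_mult_zero:
  fixes p q :: "('n, 'k::field) mpoly"
  shows "lookup (p * q) 0 = lookup p 0 * lookup q 0"
proof -
  have zero: "0 = l + m \<longleftrightarrow> l = 0 \<and> m = 0" for l m :: "'n \<Rightarrow>\<^sub>0 nat"
    by (auto simp: poly_mapping_eq_iff fun_eq_iff lookup_add)
  have "(\<Sum>m. (lookup q m when 0 = l + m)) = (lookup q 0 when l = 0)" for l
    by (cases "l = 0") (simp_all add: zero)
  then have "lookup (p * q) 0 = (\<Sum>l. (lookup p l * lookup q 0) when l = 0)"
    by (simp add: lookup_mult mult_when)
  then show ?thesis by simp
qed

lemma lookup_monomial_mult:
  fixes p :: "('n, 'k::field) mpoly"
  shows "lookup (Poly_Mapping.single m c * p) (m + m') = c * lookup p m'"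
proof -
  have "lookup (Poly_Mapping.single m c) l * (\<Sum>q. (lookup p q when m + m' = l + q))
      = (c * lookup p m' when l = m)" for l
    by (cases "l = m") (simp_all add: lookup_single)
  then show ?thesis by (simp add: lookup_mult)
qed

lemma keys_multE:
  assumes "m \<in> keys (p * q)"
  obtains a b where "a \<in> keys p" "b \<in> keys q" "m = a + b"
  using assms keys_mult by blast

lemma poly_mapping_sum_singles: "(\<Sum>m\<in>keys p. Poly_Mapping.single m (lookup p m)) = p"
proof (rule poly_mapping_eqI)
  fix m
  show "lookup (\<Sum>m\<in>keys p. Poly_Mapping.single m (lookup p m)) m = lookup p m"
    unfolding lookup_sum lookup_single when_def by (simp add: in_keys_iff)
qed

lemma in_free_module_iff: "v \<in> free_module r \<longleftrightarrow> (\<forall>j k. lookup v (j, k) \<noteq> 0 \<longrightarrow> k < r j)"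
  by (auto simp: free_module_def in_keys_iff)

lemma fhomogeneous_iff:
  "fhomogeneous t v \<longleftrightarrow> (\<forall>j k m. lookup (lookup v (j, k)) m \<noteq> 0 \<longrightarrow> j + mono_degree m = t)"
  by (force simp: fhomogeneous_def in_keys_iff)

lemma subspace_free_module: "fm.subspace (free_module r)"
proof (rule fm.subspaceI)
  fix u v :: "('a, 'b) fmod" assume uv: "u \<in> free_module r" "v \<in> free_module r"
  have "lookup u b \<noteq> 0 \<or> lookup v b \<noteq> 0" if "lookup (u + v) b \<noteq> 0" for b
    using that by (auto simp: lookup_add)
  then show "u + v \<in> free_module r" using uv unfolding in_free_module_iff by blast
next
  fix c and u :: "('a, 'b) fmod" assume u: "u \<in> free_module r"
  have "lookup u b \<noteq> 0" if "lookup (fscale c u) b \<noteq> 0" for b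
    using that by (auto simp: lookup_fscale)
  then show "fscale c u \<in> free_module r" using u unfolding in_free_module_iff by blast
qed (simp add: in_free_module_iff)

lemmas free_module_add = fm.subspace_add [OF subspace_free_module]
  and free_module_diff = fm.subspace_diff [OF subspace_free_module]
  and free_module_fscale = fm.subspace_scale [OF subspace_free_module]
  and free_module_zero = fm.subspace_0 [OF subspace_free_module]

lemma basis_vec_in_free_module: "k < r j \<Longrightarrow> basis_vec (j, k) \<in> free_module r"
  by (simp add: free_module_def)

lemma fhomogeneous_zero [simp]: "fhomogeneous t 0"
  by (simp add: fhomogeneous_iff)

lemma fhomogeneous_add:
  assumes "fhomogeneous t u" "fhomogeneous t v"
  shows "fhomogeneous t (u + v)"
proof -
  have "lookup (lookup u b) m \<noteq> 0 \<or> lookup (lookup v b) m \<noteq> 0"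
    if "lookup (lookup (u + v) b) m \<noteq> 0" for b m
    using that by (auto simp: lookup_add)
  then show ?thesis using assms unfolding fhomogeneous_iff by blast
qed

lemma fhomogeneous_diff:
  assumes "fhomogeneous t u" "fhomogeneous t v"
  shows "fhomogeneous t (u - v)"
proof -
  have "lookup (lookup u b) m \<noteq> 0 \<or> lookup (lookup v b) m \<noteq> 0"
    if "lookup (lookup (u - v) b) m \<noteq> 0" for b m
    using that by (auto simp: lookup_minus)
  then show ?thesis using assms unfolding fhomogeneous_iff by blast
qed

lemma fhomogeneous_sum:
  "(\<And>x. x \<in> A \<Longrightarrow> fhomogeneous t (f x)) \<Longrightarrow> fhomogeneous t (sum f A)"
  by (induction A rule: infinite_finite_induct) (simp_all add: fhomogeneous_add)

lemma fhomogeneous_fscale: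
  assumes "homogeneous s p" "fhomogeneous t v"
  shows "fhomogeneous (s + t) (fscale p v)"
  unfolding fhomogeneous_iff
proof (intro allI impI)
  fix j k m assume "lookup (lookup (fscale p v) (j, k)) m \<noteq> 0"
  then have "m \<in> keys (p * lookup v (j, k))" by (simp add: lookup_fscale in_keys_iff)
  then obtain a b where ab: "a \<in> keys p" "b \<in> keys (lookup v (j, k))" "m = a + b"
    by (rule keys_multE)
  with assms show "j + mono_degree m = s + t"
    by (fastforce simp: homogeneous_def fhomogeneous_iff mono_degree_add in_keys_iff)
qed

lemma fhomogeneous_basis_vec: "fhomogeneous j (basis_vec (j, k))"
  unfolding fhomogeneous_def by simp

lemma homogeneous_monomial: "homogeneous (mono_degree m) (Poly_Mapping.single m c)"
  by (simp add: homogeneous_def)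

lemma homogeneous_coefficient:
  assumes "fhomogeneous t v" "lookup v (j, k) \<noteq> 0"
  shows "j \<le> t" and "homogeneous (t - j) (lookup v (j, k))"
proof -
  obtain m where "lookup (lookup v (j, k)) m \<noteq> 0"
    using assms(2) by (metis lookup_zero poly_mapping_eqI)
  then show "j \<le> t" using assms(1) by (force simp: fhomogeneous_iff)
  show "homogeneous (t - j) (lookup v (j, k))"
    using assms(1) by (fastforce simp: fhomogeneous_iff homogeneous_def in_keys_iff)
qed

lemma free_module_expand: "v = (\<Sum>b\<in>keys v. fscale (lookup v b) (basis_vec b))"
proof (rule poly_mapping_eqI)
  fix b
  have "lookup (\<Sum>b\<in>keys v. fscale (lookup v b) (basis_vec b)) b
      = (\<Sum>b'\<in>keys v. if b' = b then lookup v b' else 0)"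
    unfolding lookup_sum lookup_fscale lookup_single when_def by (intro sum.cong) auto
  also have "\<dots> = lookup v b" by (simp add: in_keys_iff)
  finally show "lookup v b = lookup (\<Sum>b\<in>keys v. fscale (lookup v b) (basis_vec b)) b" ..
qed

lemma fhom_expand:
  assumes "fhom f"
  shows "f v = (\<Sum>b\<in>keys v. fscale (lookup v b) (f (basis_vec b)))"
  by (simp only: module_hom.scale[OF assms, symmetric] module_hom.sum[OF assms, symmetric]
      free_module_expand[symmetric])

lemma fhom_eqI:
  assumes "fhom f" "fhom g" "v \<in> free_module r"
    and "\<And>j k. k < r j \<Longrightarrow> f (basis_vec (j, k)) = g (basis_vec (j, k))"
  shows "f v = g v"
  unfolding fhom_expand[OF assms(1), of v] fhom_expand[OF assms(2), of v]
  using assms(3,4) by (intro sum.cong refl) (auto simp: in_free_module_iff in_keys_iff)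

lemma fhom_mem:
  assumes "fhom f" "v \<in> free_module r" "fm.subspace X"
    and "\<And>j k. k < r j \<Longrightarrow> f (basis_vec (j, k)) \<in> X"
  shows "f v \<in> X"
  unfolding fhom_expand[OF assms(1), of v]
  using assms(2-4)
  by (intro fm.subspace_sum[OF assms(3)] fm.subspace_scale[OF assms(3)])
     (auto simp: in_free_module_iff in_keys_iff)

text \<open>
  A homomorphism out of the ambient free module is determined by arbitrary values on the basis. All
  maps below are produced in this way.
\<close>
definition linear_ext :: "(nat \<times> nat \<Rightarrow> ('n, 'k::field) fmod) \<Rightarrow> ('n, 'k) fmod \<Rightarrow> ('n, 'k) fmod"
  where "linear_ext c v = (\<Sum>b\<in>keys v. fscale (lookup v b) (c b))"

lemma linear_ext_superset:
  assumes "finite A" "keys v \<subseteq> A"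
  shows "linear_ext c v = (\<Sum>b\<in>A. fscale (lookup v b) (c b))"
  unfolding linear_ext_def using assms
  by (intro sum.mono_neutral_left) (auto simp: in_keys_iff)

lemma fhom_linear_ext: "fhom (linear_ext c)"
proof (rule fhomI)
  fix u v :: "('a, 'b) fmod"
  let ?A = "keys u \<union> keys v"
  have "keys (u + v) \<subseteq> ?A" by (rule keys_add)
  then show "linear_ext c (u + v) = linear_ext c u + linear_ext c v"
    by (simp add: linear_ext_superset[of ?A] lookup_add fm.scale_left_distrib sum.distrib)
next
  fix p and v :: "('a, 'b) fmod"
  have "keys (fscale p v) \<subseteq> keys v" by (auto simp: in_keys_iff lookup_fscale)
  then show "linear_ext c (fscale p v) = fscale p (linear_ext c v)"
    by (simp add: linear_ext_superset[of "keys v"] lookup_fscale fm.scale_sum_right)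
qed

lemma linear_ext_basis_vec [simp]: "linear_ext c (basis_vec b) = c b"
  by (simp add: linear_ext_def)

lemma in_max_fhom:
  assumes "fhom f" "in_max_submodule v"
  shows "in_max_submodule (f v)"
  unfolding fhom_expand[OF assms(1), of v] using assms(2)
  unfolding in_max_submodule_def by (simp only: lookup_sum lookup_fscale lookup_mult_zero) simp

lemma subspace_max_submodule: "fm.subspace {v. in_max_submodule v}"
  by (auto simp: fm.subspace_def in_max_submodule_def lookup_add lookup_fscale lookup_mult_zero)

text \<open>
  The component of degree \<open>t\<close>, where the basis element \<open>(j, k)\<close> counts with degree \<open>j\<close>.
\<close>
definition hcomp :: "nat \<Rightarrow> ('n::finite, 'k::field) fmod \<Rightarrow> ('n, 'k) fmod" where
  "hcomp t v = Poly_Mapping.mapp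
     (\<lambda>(j, k). Poly_Mapping.mapp (\<lambda>m c. c when j + mono_degree m = t)) v"

lemma lookup_hcomp:
  "lookup (lookup (hcomp t v) (j, k)) m = (lookup (lookup v (j, k)) m when j + mono_degree m = t)"
  by (auto simp: hcomp_def lookup_mapp when_def in_keys_iff)

lemma fmod_eqI: "(\<And>j k m. lookup (lookup u (j, k)) m = lookup (lookup v (j, k)) m) \<Longrightarrow> u = v"
  by (intro poly_mapping_eqI) auto

lemma fhomogeneous_hcomp: "fhomogeneous t (hcomp t v)"
  by (auto simp: fhomogeneous_iff lookup_hcomp)

lemma hcomp_add: "hcomp t (u + v) = hcomp t u + hcomp t v"
  by (rule fmod_eqI) (simp add: lookup_hcomp lookup_add when_add_distrib)

lemma hcomp_zero [simp]: "hcomp t 0 = 0"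
  by (simp add: hcomp_def fmod_eqI lookup_mapp)

lemma hcomp_sum: "hcomp t (sum f A) = (\<Sum>x\<in>A. hcomp t (f x))"
  by (induction A rule: infinite_finite_induct) (simp_all add: hcomp_add)

lemma hcomp_fhomogeneous: "fhomogeneous s v \<Longrightarrow> hcomp t v = (v when s = t)"
  by (rule fmod_eqI) (auto simp: lookup_hcomp fhomogeneous_iff when_def)

lemma hcomp_free_module: "v \<in> free_module r \<Longrightarrow> hcomp t v \<in> free_module r"
  unfolding in_free_module_iff
  by (metis lookup_hcomp lookup_zero poly_mapping_eqI zero_when)

text \<open>
  A finite set of degrees outside of which all components of \<open>v\<close> vanish.
\<close>
definition fdegrees :: "('n::finite, 'k::field) fmod \<Rightarrow> nat set" where
  "fdegrees v = (\<Union>(j, k)\<in>keys v. (\<lambda>m. j + mono_degree m) ` keys (lookup v (j, k)))"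

lemma sum_hcomp: "v = (\<Sum>t\<in>fdegrees v. hcomp t v)"
proof (rule fmod_eqI)
  fix j k m
  have fin: "finite (fdegrees v)" by (auto simp: fdegrees_def)
  have "lookup (lookup v (j, k)) m = 0 \<or> j + mono_degree m \<in> fdegrees v"
    by (force simp: fdegrees_def in_keys_iff)
  then show "lookup (lookup v (j, k)) m = lookup (lookup (\<Sum>t\<in>fdegrees v. hcomp t v) (j, k)) m"
    unfolding lookup_sum lookup_hcomp when_def sum.delta'[OF fin] by auto
qed

section \<open>Graded homomorphisms of free modules\<close>

text \<open>
  Homomorphisms that raise degrees by \<open>s\<close>. As in the definition of a resolution, such a map is
  given on the ambient module, and only its restriction to \<open>free_module r\<close> matters.
\<close>
definition graded_hom :: "nat \<Rightarrow> (nat \<Rightarrow> nat) \<Rightarrow> (nat \<Rightarrow> nat) \<Rightarrow>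
    (('n::finite, 'k::field) fmod \<Rightarrow> ('n, 'k) fmod) \<Rightarrow> bool" where
  "graded_hom s r r' f \<longleftrightarrow> fhom f \<and> f ` free_module r \<subseteq> free_module r' \<and>
     (\<forall>t. \<forall>v\<in>free_module r. fhomogeneous t v \<longrightarrow> fhomogeneous (s + t) (f v))"

lemma graded_homD:
  assumes "graded_hom s r r' f"
  shows "fhom f" "\<And>v. v \<in> free_module r \<Longrightarrow> f v \<in> free_module r'"
    "\<And>v t. v \<in> free_module r \<Longrightarrow> fhomogeneous t v \<Longrightarrow> fhomogeneous (s + t) (f v)"
  using assms by (auto simp: graded_hom_def)

lemma graded_homI:
  fixes f :: "('n::finite, 'k::field) fmod \<Rightarrow> ('n, 'k) fmod"
  assumes f: "fhom f"
    and "\<And>j k. k < r j \<Longrightarrow> f (basis_vec (j, k)) \<in> free_module r'"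
    and h: "\<And>j k. k < r j \<Longrightarrow> fhomogeneous (s + j) (f (basis_vec (j, k)))"
  shows "graded_hom s r r' f"
  unfolding graded_hom_def
proof (intro conjI f image_subsetI allI ballI impI)
  fix v :: "('n, 'k) fmod" assume v: "v \<in> free_module r"
  show "f v \<in> free_module r'"
    by (rule fhom_mem[OF f v subspace_free_module]) (use assms in auto)
  fix t assume t: "fhomogeneous t v"
  show "fhomogeneous (s + t) (f v)"
    unfolding fhom_expand[OF f, of v]
  proof (rule fhomogeneous_sum)
    fix b assume b: "b \<in> keys v"
    obtain j k where [simp]: "b = (j, k)" by (cases b)
    have nz: "lookup v (j, k) \<noteq> 0" using b by (simp add: in_keys_iff)
    have "k < r j" using nz v by (simp add: in_free_module_iff)
    then have "fhomogeneous (t - j + (s + j)) (fscale (lookup v b) (f (basis_vec b)))"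
      using fhomogeneous_fscale[OF homogeneous_coefficient(2)[OF t nz] h] by simp
    then show "fhomogeneous (s + t) (fscale (lookup v b) (f (basis_vec b)))"
      using homogeneous_coefficient(1)[OF t nz] by (simp add: add.commute)
  qed
qed

lemma graded_hom_compose:
  "graded_hom s r' r'' f \<Longrightarrow> graded_hom s' r r' g \<Longrightarrow> graded_hom (s + s') r r'' (\<lambda>v. f (g v))"
  using fhom_compose[of f g] unfolding graded_hom_def by (simp add: image_subset_iff add.assoc)

lemma graded_hom_0: "graded_hom s r r' f \<Longrightarrow> f 0 = 0"
  by (rule module_hom.zero[OF graded_homD(1)])

lemma graded_hom_compose0:
  "graded_hom 0 r' r'' f \<Longrightarrow> graded_hom 0 r r' g \<Longrightarrow> graded_hom 0 r r'' (\<lambda>v. f (g v))"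
  using graded_hom_compose[of 0 r' r'' f 0 r g] by simp

lemma graded_hom_diff:
  "graded_hom s r r' f \<Longrightarrow> graded_hom s r r' g \<Longrightarrow> graded_hom s r r' (\<lambda>v. f v - g v)"
  using fhom_diff[of f g] unfolding graded_hom_def
  by (simp add: image_subset_iff free_module_diff fhomogeneous_diff)

lemma graded_hom_id: "graded_hom 0 r r (\<lambda>v. v)"
  by (simp add: graded_hom_def fhom_id)

lemma graded_hom_zero: "graded_hom s r r' (\<lambda>v. 0)"
  by (auto simp: graded_hom_def fhom_zero free_module_zero)

text \<open>
  Both sides are the only summand of degree \<open>s + t\<close> in the image of the decomposition of \<open>v\<close> into
  components.
\<close>
lemma graded_hom_hcomp:
  assumes f: "graded_hom s r r' f" and v: "v \<in> free_module r"
  shows "hcomp (s + t) (f v) = f (hcomp t v)"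
proof -
  have fin: "finite (fdegrees v)" by (auto simp: fdegrees_def)
  have "f v = (\<Sum>t'\<in>fdegrees v. f (hcomp t' v))"
    by (simp only: module_hom.sum[OF graded_homD(1)[OF f], symmetric] sum_hcomp[symmetric])
  then have "hcomp (s + t) (f v) = (\<Sum>t'\<in>fdegrees v. hcomp (s + t) (f (hcomp t' v)))"
    by (simp add: hcomp_sum)
  also have "\<dots> = (\<Sum>t'\<in>fdegrees v. f (hcomp t (hcomp t' v)))"
  proof (rule sum.cong[OF refl])
    fix t'
    have "fhomogeneous (s + t') (f (hcomp t' v))"
      by (rule graded_homD(3)[OF f hcomp_free_module[OF v] fhomogeneous_hcomp])
    then show "hcomp (s + t) (f (hcomp t' v)) = f (hcomp t (hcomp t' v))"
      by (simp add: hcomp_fhomogeneous[where s = "s + t'"] hcomp_fhomogeneous[OF fhomogeneous_hcomp]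
          when_def module_hom.zero[OF graded_homD(1)[OF f]])
  qed
  also have "\<dots> = f (\<Sum>t'\<in>fdegrees v. hcomp t (hcomp t' v))"
    by (simp add: module_hom.sum[OF graded_homD(1)[OF f]])
  also have "\<dots> = f (hcomp t v)"
    by (simp only: hcomp_sum[symmetric] sum_hcomp[symmetric])
  finally show ?thesis .
qed

text \<open>
  Free modules are projective: a preimage can be chosen for each basis element separately. Passing to
  the homogeneous component of the right degree in each preimage makes the lift graded.
\<close>
lemma graded_lift:
  assumes a: "graded_hom s r x \<alpha>" and d: "graded_hom 0 r' x \<delta>"
    and sub: "\<alpha> ` free_module r \<subseteq> \<delta> ` free_module r'"
  obtains \<beta> where "graded_hom s r r' \<beta>" "\<And>v. v \<in> free_module r \<Longrightarrow> \<delta> (\<beta> v) = \<alpha> v"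
proof -
  have "\<exists>w. w \<in> free_module r' \<and> fhomogeneous (s + j) w \<and> \<delta> w = \<alpha> (basis_vec (j, k))"
    if jk: "k < r j" for j k
  proof -
    note b = basis_vec_in_free_module[where r = r, OF jk]
    obtain w where w: "w \<in> free_module r'" "\<delta> w = \<alpha> (basis_vec (j, k))"
      using b sub by (metis (no_types, lifting) image_iff subset_iff)
    have "\<delta> (hcomp (s + j) w) = hcomp (0 + (s + j)) (\<alpha> (basis_vec (j, k)))"
      using graded_hom_hcomp[OF d w(1)] w(2) by simp
    also have "\<dots> = \<alpha> (basis_vec (j, k))"
      using hcomp_fhomogeneous[OF graded_homD(3)[OF a b fhomogeneous_basis_vec]] by simp
    finally show ?thesis using w by (blast intro: hcomp_free_module fhomogeneous_hcomp)
  qed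
  then have "\<forall>j k. \<exists>w. k < r j \<longrightarrow> w \<in> free_module r' \<and>
      fhomogeneous (s + j) w \<and> \<delta> w = \<alpha> (basis_vec (j, k))"
    by blast
  then obtain w where w: "\<And>j k. k < r j \<Longrightarrow> w j k \<in> free_module r' \<and>
      fhomogeneous (s + j) (w j k) \<and> \<delta> (w j k) = \<alpha> (basis_vec (j, k))"
    unfolding choice_iff by blast
  let ?b = "linear_ext (\<lambda>(j, k). w j k)"
  have "graded_hom s r r' ?b"
    by (rule graded_homI[OF fhom_linear_ext]) (simp_all add: w)
  moreover have "\<delta> (?b v) = \<alpha> v" if "v \<in> free_module r" for v
    by (rule fhom_eqI[OF fhom_compose[OF graded_homD(1)[OF d] fhom_linear_ext] graded_homD(1)[OF a] that])
       (simp add: w)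
  ultimately show thesis by (rule that)
qed

section \<open>Minimal resolutions augmented to the polynomial ring\<close>

definition unit_rank :: "nat \<Rightarrow> nat" where
  "unit_rank j = (if j = 0 then 1 else 0)"

text \<open>
  A resolution of \<open>I\<close> is extended by the inclusion of \<open>I\<close> into \<open>S\<close>, where \<open>S\<close> is the free module
  on the basis element \<open>(0, 0)\<close>. This is a resolution of \<open>S/I\<close> in which the augmentation has become
  the first differential, so that one index treats all maps alike; the \<open>i\<close>-th module of the
  resolution of \<open>I\<close> sits in position \<open>i + 1\<close>.
\<close>
definition resolves :: "('n::finite, 'k::field) mpoly set \<Rightarrow> (nat \<Rightarrow> nat \<Rightarrow> nat) \<Rightarrow>
    (nat \<Rightarrow> ('n, 'k) fmod \<Rightarrow> ('n, 'k) fmod) \<Rightarrow> bool" where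
  "resolves I R D \<longleftrightarrow>
     R 0 = unit_rank \<and>
     (\<forall>i. graded_hom 0 (R (Suc i)) (R i) (D i)) \<and>
     D 0 ` free_module (R (Suc 0)) = {v \<in> free_module unit_rank. lookup v (0, 0) \<in> I} \<and>
     (\<forall>i. D (Suc i) ` free_module (R (Suc (Suc i))) = {v \<in> free_module (R (Suc i)). D i v = 0}) \<and>
     (\<forall>i. \<forall>v \<in> free_module (R (Suc (Suc i))). in_max_submodule (D (Suc i) v))"

lemma resolvesD:
  assumes "resolves I R D"
  shows "R 0 = unit_rank" "graded_hom 0 (R (Suc i)) (R i) (D i)"
    "D 0 ` free_module (R (Suc 0)) = {v \<in> free_module unit_rank. lookup v (0, 0) \<in> I}"
    "D (Suc i) ` free_module (R (Suc (Suc i))) = {v \<in> free_module (R (Suc i)). D i v = 0}"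
    "\<And>v. v \<in> free_module (R (Suc (Suc i))) \<Longrightarrow> in_max_submodule (D (Suc i) v)"
  using assms by (auto simp: resolves_def)

lemma resolves_complex:
  "resolves I R D \<Longrightarrow> v \<in> free_module (R (Suc (Suc i))) \<Longrightarrow> D i (D (Suc i) v) = 0"
  using resolvesD(4)[of I R D i] by blast

lemma unit_module_eq_single:
  assumes "v \<in> free_module unit_rank"
  shows "v = Poly_Mapping.single (0, 0) (lookup v (0, 0))"
proof (rule poly_mapping_eqI)
  fix b :: "nat \<times> nat"
  have "lookup v (j, k) = 0" if "(j, k) \<noteq> (0, 0)" for j k
  proof (rule ccontr)
    assume "lookup v (j, k) \<noteq> 0"
    then have "k < unit_rank j" using assms unfolding in_free_module_iff by blast
    then show False using that by (simp add: unit_rank_def split: if_splits)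
  qed
  then show "lookup v b = lookup (Poly_Mapping.single (0, 0) (lookup v (0, 0))) b"
    by (cases b) (auto simp: lookup_single when_def)
qed

lemma single_in_unit_module: "Poly_Mapping.single (0, 0) p \<in> free_module unit_rank"
  by (simp add: free_module_def unit_rank_def)

lemma fscale_single: "fscale p (Poly_Mapping.single b q) = Poly_Mapping.single b (p * q)"
  by (rule poly_mapping_eqI) (simp add: lookup_fscale lookup_single when_def)

lemma fhomogeneous_single:
  "fhomogeneous t (Poly_Mapping.single (0, 0) p) \<longleftrightarrow> homogeneous t p"
  by (simp add: fhomogeneous_def homogeneous_def)

lemma resolution_imp_resolves:
  assumes "minimal_graded_free_resolution I r aug \<delta>"
  shows "resolves I (case_nat unit_rank r) (case_nat (\<lambda>v. Poly_Mapping.single (0, 0) (aug v)) \<delta>)"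
proof -
  note res = assms[unfolded minimal_graded_free_resolution_def]
  let ?s = "Poly_Mapping.single (0, 0) :: ('a, 'b) mpoly \<Rightarrow> ('a, 'b) fmod"
  from res have aug: "module_hom fscale (*) aug" by blast
  have "fhom (\<lambda>v. ?s (aug v))"
    by (rule fhomI) (simp_all add: module_hom.add[OF aug] module_hom.scale[OF aug] single_add fscale_single)
  then have g0: "graded_hom 0 (r 0) unit_rank (\<lambda>v. ?s (aug v))"
    unfolding graded_hom_def using res by (auto simp: single_in_unit_module fhomogeneous_single)
  have gi: "graded_hom 0 (r (Suc i)) (r i) (\<delta> i)" for i
  proof -
    have "\<delta> i ` free_module (r (Suc i)) \<subseteq> free_module (r i)"
      using res by (cases i) auto
    then show ?thesis unfolding graded_hom_def using res by simp
  qed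
  have im: "(\<lambda>v. ?s (aug v)) ` free_module (r 0) = {v \<in> free_module unit_rank. lookup v (0, 0) \<in> I}"
    (is "?l = ?r")
  proof
    have "aug ` free_module (r 0) = I" using res by blast
    then show "?l \<subseteq> ?r" by (auto simp: single_in_unit_module)
    show "?r \<subseteq> ?l"
    proof
      fix v assume v: "v \<in> ?r"
      then obtain w where "w \<in> free_module (r 0)" "lookup v (0, 0) = aug w"
        using \<open>aug ` free_module (r 0) = I\<close> by blast
      then show "v \<in> ?l" using v unit_module_eq_single[of v] by auto
    qed
  qed
  have s0: "?s p = 0 \<longleftrightarrow> p = 0" for p
    by (metis lookup_single_eq lookup_zero single_zero)
  let ?R = "case_nat unit_rank r" and ?D = "case_nat (\<lambda>v. ?s (aug v)) \<delta>"
  have "graded_hom 0 (?R (Suc i)) (?R i) (?D i)" for i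
    using g0 gi by (cases i) simp_all
  moreover have "?D (Suc i) ` free_module (?R (Suc (Suc i))) = {v \<in> free_module (?R (Suc i)). ?D i v = 0}" for i
    using res s0 by (cases i) simp_all
  ultimately show ?thesis
    unfolding resolves_def using im res by simp
qed

lemma resolves_imp_resolution:
  fixes I :: "('n::finite, 'k::field) mpoly set"
  assumes "resolves I R D"
  shows "minimal_graded_free_resolution I (\<lambda>i. R (Suc i)) (\<lambda>v. lookup (D 0 v) (0, 0)) (\<lambda>i. D (Suc i))"
proof -
  note res = resolvesD[OF assms]
  note g = graded_homD[OF res(2)]
  let ?aug = "\<lambda>v. lookup (D 0 v) (0, 0)"
  have hom: "module_hom fscale (*) ?aug"
    by unfold_locales
      (simp_all add: module_hom.add[OF g(1)] module_hom.scale[OF g(1)] lookup_add lookup_fscale)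
  have D0: "D 0 v = Poly_Mapping.single (0, 0) (?aug v)" if "v \<in> free_module (R (Suc 0))" for v
    using g(2)[OF that] res(1) by (intro unit_module_eq_single) simp
  have aug_deg: "homogeneous t (?aug v)" if "v \<in> free_module (R (Suc 0))" "fhomogeneous t v" for t v
  proof -
    have "fhomogeneous t (D 0 v)" using g(3)[OF that] by simp
    then show ?thesis using D0[OF that(1)] fhomogeneous_single by metis
  qed
  have aug_im: "?aug ` free_module (R (Suc 0)) = I"
  proof -
    have "?aug ` free_module (R (Suc 0)) = (\<lambda>v. lookup v (0, 0)) ` (D 0 ` free_module (R (Suc 0)))"
      by (simp add: image_image)
    also have "\<dots> = I"
      unfolding res(3)
    proof
      show "I \<subseteq> (\<lambda>v. lookup v (0, 0)) ` {v \<in> free_module unit_rank. lookup v (0, 0) \<in> I}"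
      proof
        fix p assume "p \<in> I"
        then show "p \<in> (\<lambda>v. lookup v (0, 0)) ` {v \<in> free_module unit_rank. lookup v (0, 0) \<in> I}"
          by (intro image_eqI[of _ _ "Poly_Mapping.single (0, 0) p"]) (simp_all add: single_in_unit_module)
      qed
    qed auto
    finally show ?thesis .
  qed
  have ker: "{v \<in> free_module (R (Suc 0)). D 0 v = 0} = {v \<in> free_module (R (Suc 0)). ?aug v = 0}"
    using D0 by (metis (mono_tags, lifting) lookup_zero single_zero)
  have deg: "fhomogeneous t (D (Suc i) v)"
    if "v \<in> free_module (R (Suc (Suc i)))" "fhomogeneous t v" for i t v
    using g(3)[OF that] by simp
  show ?thesis
    unfolding minimal_graded_free_resolution_def One_nat_def
    using hom g(1) aug_deg deg aug_im res(4)[of 0, unfolded ker] res(4) res(5) by simp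
qed

section \<open>Comparison of resolutions\<close>

text \<open>
  Multiplication by \<open>u\<close> maps \<open>S/P\<close> to \<open>S/J\<close> when \<open>u P \<subseteq> J\<close>, and a map of modules lifts to their
  resolutions. For \<open>u = 1\<close> this compares two resolutions of the same ideal; for other \<open>u\<close> it is the
  input of the mapping cone.
\<close>
lemma chain_lift:
  fixes u :: "('n::finite, 'k::field) mpoly"
  assumes P: "resolves P Q E" and J: "resolves J R D"
    and u: "homogeneous s u" "\<And>p. p \<in> P \<Longrightarrow> u * p \<in> J"
  obtains \<phi> where "\<phi> 0 = fscale u" "\<And>i. graded_hom s (Q i) (R i) (\<phi> i)"
    "\<And>i v. v \<in> free_module (Q (Suc i)) \<Longrightarrow> D i (\<phi> (Suc i) v) = \<phi> i (E i v)"
proof -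
  \<comment> \<open>the invariant about images is what allows the next lift\<close>
  let ?ok = "\<lambda>i f. graded_hom s (Q i) (R i) f \<and>
      (\<forall>v\<in>free_module (Q (Suc i)). f (E i v) \<in> D i ` free_module (R (Suc i))) \<and> (i = 0 \<longrightarrow> f = fscale u)"
  let ?step = "\<lambda>i f g. \<forall>v\<in>free_module (Q (Suc i)). D i (g v) = f (E i v)"
  note resP = resolvesD[OF P] and resJ = resolvesD[OF J]
  have "\<exists>\<phi>. \<forall>i. ?ok i (\<phi> i) \<and> ?step i (\<phi> i) (\<phi> (Suc i))"
  proof (rule dependent_nat_choice)
    have "graded_hom s unit_rank unit_rank (fscale u)"
      unfolding graded_hom_def
      using fhom_fscale[of u] u(1) by (auto intro: free_module_fscale fhomogeneous_fscale)
    moreover have "fscale u (E 0 v) \<in> D 0 ` free_module (R (Suc 0))"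
      if "v \<in> free_module (Q (Suc 0))" for v
    proof -
      have "E 0 v \<in> {v \<in> free_module unit_rank. lookup v (0, 0) \<in> P}"
        using resP(3) that by blast
      then show ?thesis
        unfolding resJ(3) using u(2) by (simp add: free_module_fscale lookup_fscale)
    qed
    ultimately show "\<exists>f. ?ok 0 f" using resP(1) resJ(1) by auto
  next
    fix f i assume f: "?ok i f"
    have comp: "graded_hom (s + 0) (Q (Suc i)) (R i) (\<lambda>v. f (E i v))"
      by (rule graded_hom_compose[OF _ resP(2)]) (use f in blast)
    have "(\<lambda>v. f (E i v)) ` free_module (Q (Suc i)) \<subseteq> D i ` free_module (R (Suc i))"
      using f by blast
    from graded_lift[OF comp resJ(2) this]
    obtain g where g: "graded_hom s (Q (Suc i)) (R (Suc i)) g"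
      "\<And>v. v \<in> free_module (Q (Suc i)) \<Longrightarrow> D i (g v) = f (E i v)"
      by (metis add_0_right)
    have "g (E (Suc i) v) \<in> D (Suc i) ` free_module (R (Suc (Suc i)))"
      if v: "v \<in> free_module (Q (Suc (Suc i)))" for v
    proof -
      have Ev: "E (Suc i) v \<in> free_module (Q (Suc i))"
        using graded_homD(2)[OF resP(2) v] .
      have "D i (g (E (Suc i) v)) = f 0"
        using g(2)[OF Ev] resolves_complex[OF P v] by simp
      also have "f 0 = 0" using f graded_hom_0 by blast
      finally show ?thesis
        unfolding resJ(4) using graded_homD(2)[OF g(1) Ev] by simp
    qed
    then show "\<exists>g. ?ok (Suc i) g \<and> ?step i f g" using g by blast
  qed
  then show thesis using that by blast
qed

text \<open>
  A chain endomorphism \<open>\<epsilon>\<close> that vanishes in position \<open>0\<close> is null-homotopic: there are maps \<open>h\<close>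
  with \<open>\<epsilon> = D h + h D\<close>. Since the differentials of a minimal resolution have entries in the
  maximal ideal, so has \<open>\<epsilon>\<close>. The condition \<open>D h D = \<epsilon> D\<close> is all that has to be carried from one
  position to the next, so the homotopy need not be constructed as a whole sequence.
\<close>
lemma null_homotopic_in_max:
  fixes I :: "('n::finite, 'k::field) mpoly set"
  assumes I: "resolves I R D"
    and \<epsilon>: "\<And>i. graded_hom 0 (R i) (R i) (\<epsilon> i)"
    and comm: "\<And>i v. v \<in> free_module (R (Suc i)) \<Longrightarrow> D i (\<epsilon> (Suc i) v) = \<epsilon> i (D i v)"
    and \<epsilon>0: "\<And>v. v \<in> free_module (R 0) \<Longrightarrow> \<epsilon> 0 v = 0"
    and v: "v \<in> free_module (R (Suc i))"
  shows "in_max_submodule (\<epsilon> (Suc i) v)"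
proof -
  note res = resolvesD[OF I]
  \<comment> \<open>the homotopy starts with \<open>h = 0\<close> in position \<open>0\<close>, where \<open>h D\<close> must not contribute:
    the first differential \<open>D 0\<close> need not have its entries in the maximal ideal\<close>
  let ?ok = "\<lambda>i h. graded_hom 0 (R i) (R (Suc i)) h \<and>
      (\<forall>v\<in>free_module (R (Suc i)). D i (h (D i v)) = \<epsilon> i (D i v)) \<and> (i = 0 \<longrightarrow> h = (\<lambda>v. 0))"
  have step: "\<exists>h'. graded_hom 0 (R (Suc i)) (R (Suc (Suc i))) h' \<and>
      (\<forall>v\<in>free_module (R (Suc i)). D (Suc i) (h' v) = \<epsilon> (Suc i) v - h (D i v))"
    if h: "?ok i h" for i h
  proof -
    let ?a = "\<lambda>v. \<epsilon> (Suc i) v - h (D i v)"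
    have a: "graded_hom 0 (R (Suc i)) (R (Suc i)) ?a"
      by (rule graded_hom_diff[OF \<epsilon> graded_hom_compose0[OF _ res(2)]]) (use h in blast)
    have "?a ` free_module (R (Suc i)) \<subseteq> D (Suc i) ` free_module (R (Suc (Suc i)))"
    proof (rule image_subsetI)
      fix v :: "('n, 'k) fmod" assume v: "v \<in> free_module (R (Suc i))"
      have "D i (?a v) = D i (\<epsilon> (Suc i) v) - D i (h (D i v))"
        by (rule module_hom.diff[OF graded_homD(1)[OF res(2)]])
      also have "\<dots> = 0" using h v comm[OF v] by simp
      finally show "?a v \<in> D (Suc i) ` free_module (R (Suc (Suc i)))"
        unfolding res(4) using graded_homD(2)[OF a v] by simp
    qed
    from graded_lift[OF a res(2) this] show ?thesis by metis
  qed
  have "\<exists>h. ?ok i h" for i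
  proof (induction i)
    case 0
    have "D 0 0 = 0" by (rule module_hom.zero[OF graded_homD(1)[OF res(2)]])
    moreover have "\<epsilon> 0 (D 0 v) = 0" if "v \<in> free_module (R (Suc 0))" for v
      by (rule \<epsilon>0[OF graded_homD(2)[OF res(2) that]])
    ultimately show ?case
      by (intro exI[of _ "\<lambda>v. 0"]) (simp add: graded_hom_zero)
  next
    case (Suc i)
    then obtain h where h: "?ok i h" by blast
    obtain h' where h': "graded_hom 0 (R (Suc i)) (R (Suc (Suc i))) h'"
      "\<And>v. v \<in> free_module (R (Suc i)) \<Longrightarrow> D (Suc i) (h' v) = \<epsilon> (Suc i) v - h (D i v)"
      using step[OF h] by blast
    have "D (Suc i) (h' (D (Suc i) v)) = \<epsilon> (Suc i) (D (Suc i) v)"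
      if v: "v \<in> free_module (R (Suc (Suc i)))" for v
    proof -
      have "h 0 = 0" using h graded_hom_0 by blast
      then show ?thesis
        using h'(2)[OF graded_homD(2)[OF res(2) v]] resolves_complex[OF I v] by simp
    qed
    with h' show ?case by auto
  qed
  then obtain h where h: "?ok i h" by blast
  then obtain h' where h': "graded_hom 0 (R (Suc i)) (R (Suc (Suc i))) h'"
      "\<And>v. v \<in> free_module (R (Suc i)) \<Longrightarrow> D (Suc i) (h' v) = \<epsilon> (Suc i) v - h (D i v)"
    using step[OF h] by blast
  have "in_max_submodule (h (D i v))"
  proof (cases i)
    case 0
    then show ?thesis using h by (simp add: in_max_submodule_def)
  next
    case (Suc i')
    show ?thesis
      by (rule in_max_fhom[OF graded_homD(1)[of _ _ _ h]]) (use h Suc v res(5)[of _ i'] in auto)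
  qed
  moreover have "in_max_submodule (D (Suc i) (h' v))"
    by (rule res(5)[OF graded_homD(2)[OF h'(1) v]])
  ultimately have "in_max_submodule (D (Suc i) (h' v) + h (D i v))"
    using fm.subspace_add[OF subspace_max_submodule] by blast
  then show ?thesis using h'(2)[OF v] by simp
qed

text \<open>
  Let \<open>f\<close> and \<open>g\<close> be comparison maps between the two resolutions. On a basis element \<open>b\<close> of degree
  \<open>j\<close> the vector \<open>g (f b) - b\<close> has entries in the maximal ideal. If the other resolution had no
  basis element of degree \<open>j\<close> in this position, then the entries of \<open>f b\<close>, being homogeneous of
  positive degree, would lie in the maximal ideal as well, and hence so would \<open>b\<close> itself.
\<close>
lemma betti_support_unique:
  fixes I :: "('n::finite, 'k::field) mpoly set"
  assumes I: "resolves I R D" and I': "resolves I R' D'" and nz: "R (Suc i) j \<noteq> 0"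
  shows "R' (Suc i) j \<noteq> 0"
proof
  assume z: "R' (Suc i) j = 0"
  have one: "homogeneous 0 (1 :: ('n, 'k) mpoly)" by (simp add: homogeneous_def)
  obtain f where f: "f 0 = fscale 1" "\<And>i. graded_hom 0 (R i) (R' i) (f i)"
    "\<And>i v. v \<in> free_module (R (Suc i)) \<Longrightarrow> D' i (f (Suc i) v) = f i (D i v)"
    using chain_lift[OF I I' one] by (metis mult_1)
  obtain g where g: "g 0 = fscale 1" "\<And>i. graded_hom 0 (R' i) (R i) (g i)"
    "\<And>i v. v \<in> free_module (R' (Suc i)) \<Longrightarrow> D i (g (Suc i) v) = g i (D' i v)"
    using chain_lift[OF I' I one] by (metis mult_1)
  let ?e = "\<lambda>i v. g i (f i v) - v"
  let ?b = "basis_vec (j, 0) :: ('n, 'k) fmod"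
  have b: "?b \<in> free_module (R (Suc i))" using nz by (intro basis_vec_in_free_module) simp
  have "in_max_submodule (?e (Suc i) ?b)"
  proof (rule null_homotopic_in_max[where \<epsilon> = ?e, OF I])
    show "graded_hom 0 (R i) (R i) (?e i)" for i
      by (rule graded_hom_diff[OF graded_hom_compose0[OF g(2) f(2)] graded_hom_id])
    show "D i (?e (Suc i) v) = ?e i (D i v)" if v: "v \<in> free_module (R (Suc i))" for i v
    proof -
      have "D i (?e (Suc i) v) = D i (g (Suc i) (f (Suc i) v)) - D i v"
        by (rule module_hom.diff[OF graded_homD(1)[OF resolvesD(2)[OF I]]])
      then show ?thesis using g(3)[OF graded_homD(2)[OF f(2) v]] f(3)[OF v] by simp
    qed
    show "?e 0 v = 0" for v using f(1) g(1) by simp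
  qed (rule b)
  moreover have "in_max_submodule (g (Suc i) (f (Suc i) ?b))"
  proof (rule in_max_fhom[OF graded_homD(1)[OF g(2)]])
    have fb: "f (Suc i) ?b \<in> free_module (R' (Suc i))" "fhomogeneous j (f (Suc i) ?b)"
      using graded_homD(2,3)[OF f(2) b] fhomogeneous_basis_vec[of j 0] by force+
    show "in_max_submodule (f (Suc i) ?b)"
      unfolding in_max_submodule_def
    proof (rule allI, rule ccontr)
      fix c assume nz: "lookup (lookup (f (Suc i) ?b) c) 0 \<noteq> 0"
      obtain j' k where c: "c = (j', k)" by (cases c)
      have "j' = j" using nz fb(2) c by (force simp: fhomogeneous_iff)
      moreover have "lookup (f (Suc i) ?b) (j', k) \<noteq> 0" using nz c by auto
      ultimately show False using fb(1) z unfolding in_free_module_iff by (metis less_nat_zero_code)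
    qed
  qed
  ultimately have "in_max_submodule (g (Suc i) (f (Suc i) ?b) - ?e (Suc i) ?b)"
    using fm.subspace_diff[OF subspace_max_submodule] by blast
  then have "in_max_submodule ?b" by simp
  then have "lookup (lookup ?b (j, 0)) 0 = 0" unfolding in_max_submodule_def by blast
  then show False by simp
qed

text \<open>
  The Betti numbers are those of some chosen minimal resolution; its support agrees with that of any
  other one.
\<close>
lemma regularity_eq_resolution:
  fixes I :: "('n::finite, 'k::field) mpoly set"
  assumes "resolves I R D"
  shows "regularity I = Sup {ereal (real j - real i) | i j. R (Suc i) j \<noteq> 0}"
proof -
  have "\<exists>aug \<delta>. minimal_graded_free_resolution I (betti I) aug \<delta>"
    unfolding betti_def using resolves_imp_resolution[OF assms]
    by (intro someI_ex[of "\<lambda>r. \<exists>aug \<delta>. minimal_graded_free_resolution I r aug \<delta>"]) blast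
  then obtain D' where "resolves I (case_nat unit_rank (betti I)) D'"
    using resolution_imp_resolves by blast
  then have "betti I i j \<noteq> 0 \<longleftrightarrow> R (Suc i) j \<noteq> 0" for i j
    using betti_support_unique[OF assms, of _ D' i j] betti_support_unique[OF _ assms, of _ D' i j]
    by fastforce
  then show ?thesis by (simp add: regularity_def)
qed

section \<open>Existence of minimal resolutions\<close>

text \<open>
  Restricting scalars to the constants turns the free module into a vector space over the ground field,
  whose homogeneous parts inside \<open>free_module r\<close> are finite-dimensional.
\<close>
abbreviation kscale :: "'k::field \<Rightarrow> ('n, 'k) fmod \<Rightarrow> ('n, 'k) fmod" where
  "kscale c \<equiv> fscale (Poly_Mapping.single 0 c)"

interpretation kv: vector_space kscale
proof
  show "kscale 1 v = v" for v by (metis fm.scale_one single_one)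
qed (simp_all add: fm.scale_right_distrib single_add fm.scale_left_distrib mult_single)

lemma kv_subspace: "fm.subspace X \<Longrightarrow> kv.subspace X"
  by (simp add: fm.subspace_def kv.subspace_def)

lemma fscale_expand_monomials:
  "fscale p v = (\<Sum>m\<in>keys p. kscale (lookup p m) (fscale (Poly_Mapping.single m 1) v))"
proof -
  have "(\<Sum>m\<in>keys p. kscale (lookup p m) (fscale (Poly_Mapping.single m 1) v))
      = (\<Sum>m\<in>keys p. fscale (Poly_Mapping.single m (lookup p m)) v)"
    by (simp add: mult_single)
  also have "\<dots> = fscale (\<Sum>m\<in>keys p. Poly_Mapping.single m (lookup p m)) v"
    by (rule fm.scale_sum_left[symmetric])
  finally show ?thesis by (simp only: poly_mapping_sum_singles)
qed

lemma finite_bounded_degree: "finite {m :: 'n::finite \<Rightarrow>\<^sub>0 nat. mono_degree m \<le> t}"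
proof (rule finite_imageD)
  have le: "lookup m i \<le> mono_degree m" for m :: "'n \<Rightarrow>\<^sub>0 nat" and i
    unfolding mono_degree_def by (rule member_le_sum) auto
  have "lookup ` {m :: 'n \<Rightarrow>\<^sub>0 nat. mono_degree m \<le> t} \<subseteq> PiE UNIV (\<lambda>_. {..t})"
  proof (rule image_subsetI)
    fix m :: "'n \<Rightarrow>\<^sub>0 nat" assume "m \<in> {m. mono_degree m \<le> t}"
    then have "lookup m i \<le> t" for i using le[of m i] by simp
    then show "lookup m \<in> PiE UNIV (\<lambda>_. {..t})" by (intro PiE_I) simp_all
  qed
  then show "finite (lookup ` {m :: 'n \<Rightarrow>\<^sub>0 nat. mono_degree m \<le> t})"
    by (rule finite_subset) (rule finite_PiE, simp_all)
  show "inj_on lookup {m :: 'n \<Rightarrow>\<^sub>0 nat. mono_degree m \<le> t}"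
    by (rule inj_onI) (simp only: poly_mapping_eq_iff)
qed

lemma finite_dimensional_degree_part:
  obtains T :: "('n::finite, 'k::field) fmod set"
  where "finite T" "{v \<in> free_module r. fhomogeneous t v} \<subseteq> kv.span T"
proof
  let ?f = "\<lambda>(b, m). fscale (Poly_Mapping.single m 1) (basis_vec b) :: ('n, 'k) fmod"
  let ?S = "(SIGMA j:{..t}. {..<r j}) \<times> {m :: 'n \<Rightarrow>\<^sub>0 nat. mono_degree m \<le> t}"
  show "finite (?f ` ?S)" by (intro finite_imageI finite_cartesian_product finite_SigmaI finite_bounded_degree) simp_all
  show "{v \<in> free_module r. fhomogeneous t v} \<subseteq> kv.span (?f ` ?S)"
  proof clarify
    fix v :: "('n, 'k) fmod" assume v: "v \<in> free_module r" "fhomogeneous t v"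
    show "v \<in> kv.span (?f ` ?S)"
    proof (subst free_module_expand, rule kv.span_sum)
      fix b assume b: "b \<in> keys v"
      obtain j k where [simp]: "b = (j, k)" by (cases b)
      have k: "k < r j" using b v(1) by (auto simp: in_free_module_iff in_keys_iff)
      show "fscale (lookup v b) (basis_vec b) \<in> kv.span (?f ` ?S)"
        unfolding fscale_expand_monomials[of "lookup v b"]
      proof (intro kv.span_sum kv.span_scale kv.span_base)
        fix m assume "m \<in> keys (lookup v b)"
        then have "j + mono_degree m = t" using v(2) by (auto simp: fhomogeneous_iff in_keys_iff)
        then have "(b, m) \<in> ?S" using k by auto
        then show "fscale (Poly_Mapping.single m 1) (basis_vec b) \<in> ?f ` ?S" 
            by (intro image_eqI[where x = "(b, m)"]) simp_all
      qed
    qed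
  qed
qed

text \<open>
  Graded Nakayama lemma. In each degree \<open>t\<close> let \<open>U t\<close> span what the elements of \<open>N\<close> of smaller degree
  generate in degree \<open>t\<close>, and let \<open>B t\<close> be a smallest finite set that spans \<open>N\<close> in degree \<open>t\<close> together
  with \<open>U t\<close>. The sets \<open>B t\<close> generate \<open>N\<close> by induction on the degree. A relation among them with a
  nonzero constant coefficient would express one element of \<open>B t\<close> by the others modulo \<open>U t\<close>,
  contradicting that \<open>B t\<close> is smallest; so all relations have coefficients in the maximal ideal.
\<close>
lemma minimal_graded_cover:
  fixes N :: "('n::finite, 'k::field) fmod set"
  assumes sub: "fm.subspace N" and free: "N \<subseteq> free_module r"
    and graded: "\<And>v t. v \<in> N \<Longrightarrow> hcomp t v \<in> N"
  obtains r' \<delta> where "graded_hom 0 r' r \<delta>" "\<delta> ` free_module r' = N"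
    "\<And>v. v \<in> free_module r' \<Longrightarrow> \<delta> v = 0 \<Longrightarrow> in_max_submodule v"
proof -
  define Nt where "Nt t = {v \<in> N. fhomogeneous t v}" for t
  define U where "U t = {fscale (Poly_Mapping.single m 1) v | m v s. v \<in> Nt s \<and> s + mono_degree m = t \<and> s < t}" for t
  let ?good = "\<lambda>t B. finite B \<and> B \<subseteq> Nt t \<and> Nt t \<subseteq> kv.span (U t \<union> B)"
  have "\<exists>B. ?good t B \<and> (\<forall>B'. ?good t B' \<longrightarrow> card B \<le> card B')" for t
  proof -
    obtain T :: "('n, 'k) fmod set" where T: "finite T" "{v \<in> free_module r. fhomogeneous t v} \<subseteq> kv.span T"
      by (rule finite_dimensional_degree_part)
    obtain B where B: "B \<subseteq> Nt t" "kv.independent B" "Nt t \<subseteq> kv.span B"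
      by (rule kv.maximal_independent_subset)
    have "B \<subseteq> kv.span T" using B(1) T(2) free by (auto simp: Nt_def)
    then have "finite B" using kv.independent_span_bound[OF T(1) B(2)] by blast
    moreover have "kv.span B \<subseteq> kv.span (U t \<union> B)" by (rule kv.span_mono) auto
    ultimately have "?good t B" using B by blast
    then show ?thesis by (rule ex_has_least_nat[of "?good t"])
  qed
  then have "\<forall>t. \<exists>B. ?good t B \<and> (\<forall>B'. ?good t B' \<longrightarrow> card B \<le> card B')" by (rule allI)
  then obtain B where "\<forall>t. ?good t (B t) \<and> (\<forall>B'. ?good t B' \<longrightarrow> card (B t) \<le> card B')"
    unfolding choice_iff by (elim exE)
  then have B: "?good t (B t)" "?good t B' \<Longrightarrow> card (B t) \<le> card B'" for t B'
    by blast+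
  have "\<exists>h. bij_betw h {0..<card (B t)} (B t)" for t using B(1) ex_bij_betw_nat_finite by blast
  then have "\<forall>t. \<exists>h. bij_betw h {0..<card (B t)} (B t)" by (rule allI)
  then obtain \<beta> where \<beta>: "\<And>t. bij_betw (\<beta> t) {0..<card (B t)} (B t)"
    unfolding choice_iff by blast
  let ?r = "\<lambda>t. card (B t)"
  let ?d = "linear_ext (\<lambda>(j, k). \<beta> j k)"
  have \<beta>_im: "\<beta> t ` {0..<?r t} = B t" and \<beta>_inj: "inj_on (\<beta> t) {0..<?r t}" for t
    using \<beta>[of t] by (simp_all add: bij_betw_def)
  have \<beta>B: "\<beta> j k \<in> B j" if "k < ?r j" for j k
    using imageI[of k "{0..<?r j}" "\<beta> j"] that by (simp only: \<beta>_im) simp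
  have \<beta>N: "\<beta> j k \<in> Nt j" if "k < ?r j" for j k
    using \<beta>B[OF that] B(1) by blast
  have d: "graded_hom 0 ?r r ?d"
    using \<beta>N free by (intro graded_homI fhom_linear_ext) (auto simp: Nt_def)
  have imN: "?d v \<in> N" if "v \<in> free_module ?r" for v
    by (rule fhom_mem[OF fhom_linear_ext that sub]) (use \<beta>N in \<open>auto simp: Nt_def\<close>)
  let ?im = "?d ` free_module ?r"
  have im_sub: "fm.subspace ?im"
    by (rule module_hom.subspace_image[OF fhom_linear_ext subspace_free_module])
  have Nt_im: "Nt t \<subseteq> ?im" for t
  proof (induction t rule: less_induct)
    case (less t)
    have "U t \<subseteq> ?im"
    proof
      fix x assume "x \<in> U t"
      then obtain m v s where x: "x = fscale (Poly_Mapping.single m 1) v" and "v \<in> Nt s" "s < t"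
        unfolding U_def by blast
      then have "v \<in> ?im" using less.IH by blast
      then show "x \<in> ?im" unfolding x by (rule fm.subspace_scale[OF im_sub])
    qed
    moreover have "B t \<subseteq> ?im"
    proof
      fix x assume "x \<in> B t"
      then have "x \<in> \<beta> t ` {0..<?r t}" by (simp only: \<beta>_im)
      then obtain k where k: "k < ?r t" "x = \<beta> t k" by auto
      then show "x \<in> ?im"
        by (intro image_eqI[of _ _ "basis_vec (t, k)"]) (simp_all add: basis_vec_in_free_module)
    qed
    ultimately have "kv.span (U t \<union> B t) \<subseteq> ?im"
      by (intro kv.span_minimal kv_subspace im_sub) auto
    then show ?case using B(1) by blast
  qed
  have "N \<subseteq> ?im"
  proof
    fix v assume v: "v \<in> N"
    have "hcomp t v \<in> Nt t" for t using graded[OF v] by (simp add: Nt_def fhomogeneous_hcomp)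
    then have "hcomp t v \<in> ?im" for t using Nt_im by blast
    then show "v \<in> ?im" by (subst sum_hcomp, intro fm.subspace_sum[OF im_sub])
  qed
  with imN have im: "?im = N" by blast
  have ker: "in_max_submodule v" if v: "v \<in> free_module ?r" and v0: "?d v = 0" for v
    unfolding in_max_submodule_def
  proof (rule allI, rule ccontr)
    fix b assume nz: "lookup (lookup v b) 0 \<noteq> 0"
    obtain j k where b: "b = (j, k)" by (cases b)
    \<comment> \<open>isolating the degree of the offending entry leaves a relation in which that entry is a constant\<close>
    define w where "w = hcomp j v"
    have w: "w \<in> free_module ?r" "fhomogeneous j w"
      unfolding w_def by (simp_all add: hcomp_free_module[OF v] fhomogeneous_hcomp)
    have w0: "?d w = 0" using graded_hom_hcomp[OF d v, of j] v0 by (simp add: w_def)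
    define c where "c = lookup (lookup w b) 0"
    have c: "c \<noteq> 0" using nz by (simp add: c_def w_def b lookup_hcomp)
    have bw: "b \<in> keys w" using c by (auto simp: c_def in_keys_iff)
    have k: "k < ?r j" using bw w(1) b by (auto simp: in_free_module_iff in_keys_iff)
    let ?S = "kv.span (U j \<union> (B j - {\<beta> j k}))"
    have mono_S: "fscale (Poly_Mapping.single m 1) (\<beta> j' k') \<in> ?S"
      if jk: "(j', k') \<in> keys w" and m: "m \<in> keys (lookup w (j', k'))"
        and ne: "((j', k'), m) \<noteq> (b, 0)" for j' k' m
    proof (rule kv.span_base)
      have k': "k' < ?r j'" using jk w(1) by (auto simp: in_free_module_iff in_keys_iff)
      have deg: "j' + mono_degree m = j" using w(2) m by (auto simp: fhomogeneous_iff in_keys_iff)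
      show "fscale (Poly_Mapping.single m 1) (\<beta> j' k') \<in> U j \<union> (B j - {\<beta> j k})"
      proof (cases "m = 0")
        case True
        then have "j' = j" "k' \<noteq> k" using deg ne b by (auto simp: mono_degree_def)
        then have "\<beta> j k' \<noteq> \<beta> j k"
          using inj_onD[OF \<beta>_inj[of j], of k' k] k k' by auto
        then show ?thesis using True \<open>j' = j\<close> \<beta>B k' by simp
      next
        case False
        then have "j' < j" using deg by (metis less_add_same_cancel1 mono_degree_eq_0_iff not_gr_zero)
        then show ?thesis unfolding U_def using \<beta>N[OF k'] deg by blast
      qed
    qed
    have sumS: "fscale (lookup w x) (case x of (j, k) \<Rightarrow> \<beta> j k) \<in> ?S" if x: "x \<in> keys w - {b}" for x
    proof -
      obtain j' k' where jk: "x = (j', k')" by (cases x)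
      have "fscale (lookup w (j', k')) (\<beta> j' k') \<in> ?S"
        unfolding fscale_expand_monomials[of "lookup w (j', k')"]
      proof (intro kv.span_sum kv.span_scale)
        fix m assume "m \<in> keys (lookup w (j', k'))"
        then show "fscale (Poly_Mapping.single m 1) (\<beta> j' k') \<in> ?S"
          by (rule mono_S[rotated]) (use x jk in auto)
      qed
      then show ?thesis using jk by simp
    qed
    let ?p = "lookup w b"
    have "?d w = fscale ?p (\<beta> j k) + (\<Sum>x\<in>keys w - {b}. fscale (lookup w x) (case x of (j, k) \<Rightarrow> \<beta> j k))"
      unfolding linear_ext_def by (simp add: sum.remove[OF _ bw] b)
    also have "fscale ?p (\<beta> j k) = kscale c (\<beta> j k) +
        (\<Sum>m\<in>keys ?p - {0}. kscale (lookup ?p m) (fscale (Poly_Mapping.single m 1) (\<beta> j k)))"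
      unfolding fscale_expand_monomials[of ?p]
      by (subst sum.remove[of _ 0]) (use c in \<open>simp_all add: c_def in_keys_iff\<close>)
    finally have eq: "0 = kscale c (\<beta> j k)
          + (\<Sum>m\<in>keys ?p - {0}. kscale (lookup ?p m) (fscale (Poly_Mapping.single m 1) (\<beta> j k)))
          + (\<Sum>x\<in>keys w - {b}. fscale (lookup w x) (case x of (j, k) \<Rightarrow> \<beta> j k))"
      by (simp only: w0)
    \<comment> \<open>solve the relation for the multiple of \<open>\<beta> j k\<close>\<close>
    have move: "x = - (a + b)" if "0 = x + a + b" for x a b :: "('n, 'k) fmod"
      unfolding eq_neg_iff_add_eq_0 using that[symmetric] by (simp only: add.assoc)
    have "kscale c (\<beta> j k) =
        - ((\<Sum>m\<in>keys ?p - {0}. kscale (lookup ?p m) (fscale (Poly_Mapping.single m 1) (\<beta> j k)))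
          + (\<Sum>x\<in>keys w - {b}. fscale (lookup w x) (case x of (j, k) \<Rightarrow> \<beta> j k)))"
      by (rule move[OF eq])
    moreover have "(\<Sum>m\<in>keys ?p - {0}. kscale (lookup ?p m) (fscale (Poly_Mapping.single m 1) (\<beta> j k))) \<in> ?S"
    proof (intro kv.span_sum kv.span_scale)
      fix m assume "m \<in> keys ?p - {0}"
      then show "fscale (Poly_Mapping.single m 1) (\<beta> j k) \<in> ?S"
        by (intro mono_S) (use bw b in auto)
    qed
    moreover have "(\<Sum>x\<in>keys w - {b}. fscale (lookup w x) (case x of (j, k) \<Rightarrow> \<beta> j k)) \<in> ?S"
      by (rule kv.span_sum) (rule sumS)
    ultimately have "kscale c (\<beta> j k) \<in> ?S" by (simp only: kv.span_neg kv.span_add)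
    then have "kscale (inverse c) (kscale c (\<beta> j k)) \<in> ?S" by (rule kv.span_scale)
    then have \<beta>S: "\<beta> j k \<in> ?S" using c by (simp add: mult_single)
    have "kv.span (U j \<union> B j) \<subseteq> ?S"
    proof (rule kv.span_minimal)
      show "U j \<union> B j \<subseteq> ?S" using \<beta>S kv.span_superset[of "U j \<union> (B j - {\<beta> j k})"] by blast
    qed (rule kv.subspace_span)
    then have "?good j (B j - {\<beta> j k})" using B(1)[of j] by auto
    then have "card (B j) \<le> card (B j - {\<beta> j k})" by (rule B(2))
    then show False using \<beta>B[OF k] B(1)[of j] card_Diff1_less by (metis not_le)
  qed
  show thesis by (rule that[OF d im ker])
qed

text \<open>
  Cover \<open>I\<close> minimally by a free module, then the kernel of this cover, and so on. The second
  hypothesis says that \<open>I\<close> is homogeneous.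
\<close>
theorem minimal_resolution_exists:
  fixes I :: "('n::finite, 'k::field) mpoly set"
  assumes I: "pm.subspace I"
    and graded: "\<And>p t. p \<in> I \<Longrightarrow> lookup (hcomp t (Poly_Mapping.single (0, 0) p)) (0, 0) \<in> I"
  shows "\<exists>R D. resolves I R D"
proof -
  let ?N = "{v \<in> free_module unit_rank. lookup v (0, 0) \<in> I}"
  let ?ok = "\<lambda>(i :: nat) (r, r', \<delta>). graded_hom 0 r' r \<delta> \<and>
    (\<forall>v\<in>free_module r'. \<delta> v = 0 \<longrightarrow> in_max_submodule v) \<and>
    (i = 0 \<longrightarrow> r = unit_rank \<and> \<delta> ` free_module r' = ?N)"
  let ?step = "\<lambda>(r, r', \<delta>) (s, s', \<epsilon>). s = r' \<and> \<epsilon> ` free_module s' = {v \<in> free_module r'. \<delta> v = 0}"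
  have "\<exists>f. \<forall>i. ?ok i (f i) \<and> ?step (f i) (f (Suc i))"
  proof (rule dependent_nat_choice)
    have "fm.subspace ?N"
      unfolding fm.subspace_def using pm.subspace_0[OF I] pm.subspace_add[OF I] pm.subspace_scale[OF I]
      by (auto simp: lookup_add lookup_fscale free_module_zero free_module_add free_module_fscale)
    moreover have "hcomp t v \<in> ?N" if "v \<in> ?N" for v t
      using that hcomp_free_module[of v] graded[of "lookup v (0, 0)" t] unit_module_eq_single[of v]
      by auto
    ultimately obtain r' \<delta> where "graded_hom 0 r' unit_rank \<delta>" "\<delta> ` free_module r' = ?N"
      "\<And>v. v \<in> free_module r' \<Longrightarrow> \<delta> v = 0 \<Longrightarrow> in_max_submodule v"
      using minimal_graded_cover[of ?N unit_rank] by blast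
    then have "?ok 0 (unit_rank, r', \<delta>)" by simp
    then show "\<exists>x. ?ok 0 x" by (rule exI)
  next
    fix x i assume x: "?ok i x"
    obtain r r' \<delta> where xe: "x = (r, r', \<delta>)" by (cases x)
    have \<delta>: "graded_hom 0 r' r \<delta>" using x xe by simp
    let ?K = "{v \<in> free_module r'. \<delta> v = 0}"
    have "fm.subspace ?K"
      unfolding fm.subspace_def
      using module_hom.add[OF graded_homD(1)[OF \<delta>]] module_hom.scale[OF graded_homD(1)[OF \<delta>]]
        module_hom.zero[OF graded_homD(1)[OF \<delta>]]
      by (auto simp: free_module_zero free_module_add free_module_fscale)
    moreover have "hcomp t v \<in> ?K" if "v \<in> ?K" for v t
    proof -
      have "\<delta> (hcomp t v) = hcomp t (\<delta> v)" using graded_hom_hcomp[OF \<delta>, of v t] that by simp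
      then show ?thesis using that by (simp add: hcomp_free_module)
    qed
    ultimately obtain s' \<epsilon> where "graded_hom 0 s' r' \<epsilon>" "\<epsilon> ` free_module s' = ?K"
      "\<And>v. v \<in> free_module s' \<Longrightarrow> \<epsilon> v = 0 \<Longrightarrow> in_max_submodule v"
      using minimal_graded_cover[of ?K r'] by blast
    then have "?ok (Suc i) (r', s', \<epsilon>) \<and> ?step x (r', s', \<epsilon>)" unfolding xe by simp
    then show "\<exists>y. ?ok (Suc i) y \<and> ?step x y" by (rule exI)
  qed
  then obtain f where "\<forall>i. ?ok i (f i) \<and> ?step (f i) (f (Suc i))" by (rule exE)
  note f0 = this[THEN spec]
  have f: "?ok i (f i)" "?step (f i) (f (Suc i))" for i
    by (fact f0[THEN conjunct1], fact f0[THEN conjunct2])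
  define R where "R i = fst (f i)" for i
  define D where "D i = snd (snd (f i))" for i
  have fe: "f i = (R i, R (Suc i), D i)" for i
  proof -
    obtain r r' \<delta> s s' \<epsilon> where "f i = (r, r', \<delta>)" "f (Suc i) = (s, s', \<epsilon>)"
      by (metis surj_pair)
    then show ?thesis using f(2)[of i] by (simp only: R_def D_def fst_conv snd_conv prod.case)
  qed
  have ok: "graded_hom 0 (R (Suc i)) (R i) (D i)"
    "\<And>v. v \<in> free_module (R (Suc i)) \<Longrightarrow> D i v = 0 \<Longrightarrow> in_max_submodule v" for i
    using f(1)[of i] unfolding fe by blast+
  have zero: "R 0 = unit_rank" "D 0 ` free_module (R (Suc 0)) = ?N"
    using f(1)[of 0] unfolding fe by blast+
  have exact: "D (Suc i) ` free_module (R (Suc (Suc i))) = {v \<in> free_module (R (Suc i)). D i v = 0}" for i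
    using f(2)[of i] unfolding fe by blast
  have "in_max_submodule (D (Suc i) v)" if "v \<in> free_module (R (Suc (Suc i)))" for i v
    using exact[of i] that ok(2)[of "D (Suc i) v" i] by blast
  then have "resolves I R D"
    unfolding resolves_def using zero ok(1) exact by blast
  then show ?thesis by blast
qed

section \<open>Mapping cones\<close>

text \<open>
  The rank function of \<open>free_module a \<oplus> free_module q\<close> with the second summand shifted by \<open>d\<close>. In
  degree \<open>j\<close> the first \<open>a j\<close> basis elements belong to the left summand, and the basis element
  \<open>(j, k)\<close> of the right summand becomes \<open>(j + d, k + a (j + d))\<close>. Hence the left summand is
  included by the identity.
\<close>
definition sum_rank :: "(nat \<Rightarrow> nat) \<Rightarrow> (nat \<Rightarrow> nat) \<Rightarrow> nat \<Rightarrow> nat \<Rightarrow> nat" where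
  "sum_rank a q d j = a j + (if d \<le> j then q (j - d) else 0)"

definition inj_right :: "(nat \<Rightarrow> nat) \<Rightarrow> nat \<Rightarrow> ('n, 'k::field) fmod \<Rightarrow> ('n, 'k) fmod" where
  "inj_right a d = linear_ext (\<lambda>(j, k). basis_vec (j + d, k + a (j + d)))"

definition proj_left :: "(nat \<Rightarrow> nat) \<Rightarrow> ('n, 'k::field) fmod \<Rightarrow> ('n, 'k) fmod" where
  "proj_left a = linear_ext (\<lambda>(j, k). if k < a j then basis_vec (j, k) else 0)"

definition proj_right :: "(nat \<Rightarrow> nat) \<Rightarrow> nat \<Rightarrow> ('n, 'k::field) fmod \<Rightarrow> ('n, 'k) fmod" where
  "proj_right a d = linear_ext
     (\<lambda>(j, k). if a j \<le> k \<and> d \<le> j then basis_vec (j - d, k - a j) else 0)"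

lemma fhom_inj_right: "fhom (inj_right a d)"
  and fhom_proj_left: "fhom (proj_left a)"
  and fhom_proj_right: "fhom (proj_right a d)"
  by (simp_all add: inj_right_def proj_left_def proj_right_def fhom_linear_ext)

lemma free_module_UNIV: "\<exists>r. v \<in> free_module r"
proof
  show "v \<in> free_module (\<lambda>j. Suc (Max (snd ` keys v)))"
    by (auto simp: in_free_module_iff in_keys_iff[symmetric] less_Suc_eq_le intro!: Max_ge rev_image_eqI)
qed

lemma fhom_eq:
  assumes "fhom f" "fhom g" "\<And>j k. f (basis_vec (j, k)) = g (basis_vec (j, k))"
  shows "f v = g v"
  using fhom_eqI[OF assms(1,2)] free_module_UNIV[of v] assms(3) by blast

lemma proj_left_inj_right: "proj_left a (inj_right a d w) = 0"
  by (rule fhom_eq[OF fhom_compose[OF fhom_proj_left fhom_inj_right] fhom_zero])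
    (simp add: proj_left_def inj_right_def)

lemma proj_right_inj_right: "proj_right a d (inj_right a d w) = w"
  by (rule fhom_eq[OF fhom_compose[OF fhom_proj_right fhom_inj_right] fhom_id])
    (simp add: proj_right_def inj_right_def)

lemma proj_left_free_module: "g \<in> free_module a \<Longrightarrow> proj_left a g = g"
  by (rule fhom_eqI[OF fhom_proj_left fhom_id]) (auto simp: proj_left_def)

lemma proj_right_free_module: "g \<in> free_module a \<Longrightarrow> proj_right a d g = 0"
  by (rule fhom_eqI[OF fhom_proj_right fhom_zero]) (auto simp: proj_right_def)

lemma inj_right_in:
  assumes "w \<in> free_module q"
  shows "inj_right a d w \<in> free_module (sum_rank a q d)"
proof (rule fhom_mem[OF fhom_inj_right assms subspace_free_module])
  fix j k assume "k < q j"
  then have "basis_vec (j + d, k + a (j + d)) \<in> free_module (sum_rank a q d)"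
    by (intro basis_vec_in_free_module) (simp add: sum_rank_def)
  then show "inj_right a d (basis_vec (j, k)) \<in> free_module (sum_rank a q d)"
    by (simp add: inj_right_def)
qed

lemma proj_left_in: "proj_left a v \<in> free_module a"
proof -
  obtain r where r: "v \<in> free_module r" using free_module_UNIV by blast
  show ?thesis
  proof (rule fhom_mem[OF fhom_proj_left r subspace_free_module])
    fix j k
    show "proj_left a (basis_vec (j, k)) \<in> free_module a"
      by (cases "k < a j") (simp_all add: proj_left_def free_module_zero basis_vec_in_free_module)
  qed
qed

lemma proj_right_in:
  assumes "v \<in> free_module (sum_rank a q d)"
  shows "proj_right a d v \<in> free_module q"
proof (rule fhom_mem[OF fhom_proj_right assms subspace_free_module])
  fix j k assume k: "k < sum_rank a q d j"
  show "proj_right a d (basis_vec (j, k)) \<in> free_module q"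
  proof (cases "a j \<le> k \<and> d \<le> j")
    case True
    then have "k - a j < q (j - d)" using k by (simp add: sum_rank_def less_diff_conv2 add.commute)
    then have "basis_vec (j - d, k - a j) \<in> free_module q" by (rule basis_vec_in_free_module)
    then show ?thesis using True by (simp add: proj_right_def)
  next
    case False
    then show ?thesis unfolding proj_right_def by (auto simp: free_module_zero)
  qed
qed

lemma left_in_sum: "g \<in> free_module a \<Longrightarrow> g \<in> free_module (sum_rank a q d)"
  unfolding in_free_module_iff sum_rank_def by (meson trans_less_add1)

lemma sum_decomposition:
  assumes "v \<in> free_module (sum_rank a q d)"
  shows "v = proj_left a v + inj_right a d (proj_right a d v)"
proof (rule fhom_eqI[OF fhom_id fhom_add[OF fhom_proj_left fhom_compose[OF fhom_inj_right fhom_proj_right]] assms])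
  fix j k assume "k < sum_rank a q d j"
  then show "basis_vec (j, k) = proj_left a (basis_vec (j, k)) + inj_right a d (proj_right a d (basis_vec (j, k)))"
    using module_hom.zero[OF fhom_inj_right[of a d]]
    by (auto simp: proj_left_def proj_right_def inj_right_def sum_rank_def split: if_splits)
qed

lemma sumE:
  assumes "v \<in> free_module (sum_rank a q d)"
  obtains g w where "g \<in> free_module a" "w \<in> free_module q" "v = g + inj_right a d w"
  using sum_decomposition[OF assms] proj_left_in proj_right_in[OF assms] that by blast

lemma graded_hom_inj_right: "graded_hom d q (sum_rank a q d) (inj_right a d)"
proof (rule graded_homI[OF fhom_inj_right])
  fix j k assume "k < q j"
  then show "inj_right a d (basis_vec (j, k)) \<in> free_module (sum_rank a q d)"
    by (intro inj_right_in basis_vec_in_free_module)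
  show "fhomogeneous (d + j) (inj_right a d (basis_vec (j, k)))"
    using fhomogeneous_basis_vec[of "j + d"] by (simp add: inj_right_def add.commute)
qed

text \<open>
  The ideal \<open>J' = J + (u y)\<close> satisfies \<open>J'/J \<cong> S/(J : u y)\<close> up to a shift, and the hypotheses give
  \<open>J : u y = P\<close>. If \<open>\<phi>\<close> lifts multiplication by \<open>u\<close>, the map
  \<open>(g, w) \<mapsto> (D g + y \<phi> w, - E w)\<close> is the differential of the mapping cone of the lift \<open>y \<phi>\<close> of
  multiplication by \<open>u y\<close>. The factor \<open>y\<close> puts the mixed entries into the maximal ideal, so the cone
  is minimal. The bottom module of the cone of the two resolutions is \<open>S\<close> alone, which is why the
  second summand appears from position \<open>1\<close> on and in position \<open>i + 1\<close> has the ranks \<open>Q i\<close>.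
\<close>
theorem mapping_cone_resolution:
  fixes J P :: "('n::finite, 'k::field) mpoly set"
  assumes P: "resolves P Q E" and J: "resolves J R D"
    and u: "homogeneous s u" "\<And>p. p \<in> P \<Longrightarrow> u * p \<in> J"
    and y: "homogeneous 1 y"
    and colon: "\<And>p. u * y * p \<in> J \<Longrightarrow> p \<in> P"
    and P_max: "\<And>p. p \<in> P \<Longrightarrow> lookup p 0 = 0"
  shows "\<exists>D'. resolves {a + u * y * p | a p. a \<in> J}
     (case_nat (R 0) (\<lambda>i. sum_rank (R (Suc i)) (Q i) (Suc s))) D'"
proof -
  note resP = resolvesD[OF P] and resJ = resolvesD[OF J]
  obtain \<phi> where \<phi>: "\<phi> 0 = fscale u" "\<And>i. graded_hom s (Q i) (R i) (\<phi> i)"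
    "\<And>i v. v \<in> free_module (Q (Suc i)) \<Longrightarrow> D i (\<phi> (Suc i) v) = \<phi> i (E i v)"
    using chain_lift[OF P J u] by blast
  let ?d = "Suc s"
  let ?L = "\<lambda>i. proj_left (R (Suc i))" and ?R = "\<lambda>i. proj_right (R (Suc i)) ?d"
    and ?I = "\<lambda>i. inj_right (R (Suc i)) ?d"
  let ?R' = "case_nat (R 0) (\<lambda>i. sum_rank (R (Suc i)) (Q i) ?d)"
  \<comment> \<open>the component of the differential inside the second summand; the bottom module of the cone
    has no second summand\<close>
  define low where "low i = (case i of 0 \<Rightarrow> (\<lambda>w. 0) | Suc i' \<Rightarrow> (\<lambda>w. ?I i' (E i' w)))" for i
  define D' where "D' i v = (D i (?L i v) + fscale y (\<phi> i (?R i v))) - low i (?R i v)" for i v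

  note homD = graded_homD(1)[OF resJ(2)] and homE = graded_homD(1)[OF resP(2)]
    and hom\<phi> = graded_homD(1)[OF \<phi>(2)]
  have hom_low: "fhom (low i)" for i
    by (cases i) (simp_all add: low_def fhom_zero fhom_compose[OF fhom_inj_right homE])
  have homD': "fhom (D' i)" for i
    unfolding D'_def
    by (intro fhom_diff fhom_add fhom_compose[OF homD fhom_proj_left]
        fhom_compose[OF fhom_fscale fhom_compose[OF hom\<phi> fhom_proj_right]]
        fhom_compose[OF hom_low fhom_proj_right])
  have low_in: "low i w \<in> free_module (?R' i)" if "w \<in> free_module (Q i)" for i w
    using that graded_homD(2)[OF resP(2)]
    by (cases i) (simp_all add: low_def free_module_zero inj_right_in)
  have R_in: "g \<in> free_module (?R' i)" if "g \<in> free_module (R i)" for i g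
    using that by (cases i) (simp_all add: left_in_sum)

  have D'_eq: "D' i (g + ?I i w) = (D i g + fscale y (\<phi> i w)) - low i w"
    if "g \<in> free_module (R (Suc i))" for i g w
  proof -
    have "?L i (g + ?I i w) = g"
      using that by (simp add: module_hom.add[OF fhom_proj_left] proj_left_inj_right proj_left_free_module)
    moreover have "?R i (g + ?I i w) = w"
      using that by (simp add: module_hom.add[OF fhom_proj_right] proj_right_inj_right proj_right_free_module)
    ultimately show ?thesis by (simp only: D'_def)
  qed

  have main_in: "D i g + fscale y (\<phi> i w) \<in> free_module (R i)"
    if "g \<in> free_module (R (Suc i))" "w \<in> free_module (Q i)" for i g w
    using that by (intro free_module_add free_module_fscale graded_homD(2)[OF resJ(2)] graded_homD(2)[OF \<phi>(2)])

  have gr: "graded_hom 0 (?R' (Suc i)) (?R' i) (D' i)" for i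
  proof (rule graded_homI[OF homD'])
    fix j k assume "k < ?R' (Suc i) j"
    then have jk: "k < sum_rank (R (Suc i)) (Q i) ?d j" by simp
    let ?b = "basis_vec (j, k) :: ('n, 'k) fmod"
    have b: "?b \<in> free_module (sum_rank (R (Suc i)) (Q i) ?d)" using jk by (rule basis_vec_in_free_module)
    then obtain g w where gw: "g \<in> free_module (R (Suc i))" "w \<in> free_module (Q i)" "?b = g + ?I i w"
      by (rule sumE)
    show "D' i ?b \<in> free_module (?R' i)"
      unfolding gw(3) D'_eq[OF gw(1)]
      by (intro free_module_diff R_in main_in gw low_in)
    show "fhomogeneous (0 + j) (D' i ?b)"
    proof (cases "k < R (Suc i) j")
      case True
      then have "D' i ?b = D i ?b"
        using D'_eq[of ?b i 0] basis_vec_in_free_module[of k "R (Suc i)" j]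
        by (simp add: module_hom.zero[OF hom\<phi>] module_hom.zero[OF fhom_inj_right] module_hom.zero[OF hom_low])
      then show ?thesis
        using graded_homD(3)[OF resJ(2) basis_vec_in_free_module[where r = "R (Suc i)", OF True] fhomogeneous_basis_vec] by simp
    next
      case False
      let ?c = "basis_vec (j - ?d, k - R (Suc i) j) :: ('n, 'k) fmod"
      have dj: "?d \<le> j" and kq: "k - R (Suc i) j < Q i (j - ?d)"
        using jk False by (auto simp: sum_rank_def split: if_splits)
      have c: "?c \<in> free_module (Q i)" using kq by (rule basis_vec_in_free_module)
      have "?b = ?I i ?c" using dj False by (simp add: inj_right_def)
      then have eq: "D' i ?b = fscale y (\<phi> i ?c) - low i ?c"
        using D'_eq[of 0 i ?c] by (simp add: free_module_zero module_hom.zero[OF homD])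
      have "fhomogeneous (1 + (s + (j - ?d))) (fscale y (\<phi> i ?c))"
        by (intro fhomogeneous_fscale[OF y] graded_homD(3)[OF \<phi>(2) c] fhomogeneous_basis_vec)
      moreover have "1 + (s + (j - ?d)) = j" using dj by simp
      ultimately have h1: "fhomogeneous j (fscale y (\<phi> i ?c))" by simp
      have h2: "fhomogeneous j (low i ?c)"
      proof (cases i)
        case 0
        then show ?thesis by (simp add: low_def)
      next
        case (Suc i')
        have "fhomogeneous (?d + (0 + (j - ?d))) (?I i' (E i' ?c))"
        proof (rule graded_homD(3)[OF graded_hom_inj_right])
          have c': "?c \<in> free_module (Q (Suc i'))" using c Suc by simp
          show "E i' ?c \<in> free_module (Q i')" by (rule graded_homD(2)[OF resP(2) c'])
          show "fhomogeneous (0 + (j - ?d)) (E i' ?c)"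
            by (rule graded_homD(3)[OF resP(2) c' fhomogeneous_basis_vec])
        qed
        moreover have "?d + (0 + (j - ?d)) = j" using dj by simp
        moreover have "low i ?c = ?I i' (E i' ?c)" by (simp add: low_def Suc)
        ultimately show ?thesis by (simp only:)
      qed
      show ?thesis unfolding eq add_0 by (rule fhomogeneous_diff[OF h1 h2])
    qed
  qed

  have im0: "D' 0 ` free_module (?R' (Suc 0)) =
      {v \<in> free_module unit_rank. lookup v (0, 0) \<in> {a + u * y * p | a p. a \<in> J}}" (is "?l = ?r")
  proof
    show "?l \<subseteq> ?r"
    proof (rule image_subsetI)
      fix v :: "('n, 'k) fmod" assume "v \<in> free_module (?R' (Suc 0))"
      then have "v \<in> free_module (sum_rank (R (Suc 0)) (Q 0) ?d)" by simp
      then obtain g w where gw: "g \<in> free_module (R (Suc 0))" "w \<in> free_module (Q 0)" "v = g + ?I 0 w"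
        by (rule sumE)
      have eq: "D' 0 v = D 0 g + fscale y (fscale u w)"
        unfolding gw(3) D'_eq[OF gw(1)] by (simp add: low_def \<phi>(1))
      have "lookup (D 0 g) (0, 0) \<in> J" using resJ(3) gw(1) by blast
      moreover have "lookup (D' 0 v) (0, 0) = lookup (D 0 g) (0, 0) + u * y * lookup w (0, 0)"
        unfolding eq by (simp only: lookup_add lookup_fscale mult.assoc mult.left_commute)
      moreover have "D' 0 v \<in> free_module unit_rank"
        using main_in[OF gw(1,2)] unfolding eq \<phi>(1) resJ(1) by simp
      ultimately show "D' 0 v \<in> ?r"
        by (intro CollectI conjI exI[of _ "lookup (D 0 g) (0, 0)"] exI[of _ "lookup w (0, 0)"])
    qed
    show "?r \<subseteq> ?l"
    proof
      fix v :: "('n, 'k) fmod" assume v: "v \<in> ?r"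
      then obtain a p where ap: "lookup v (0, 0) = a + u * y * p" "a \<in> J" by blast
      have "Poly_Mapping.single (0, 0) a \<in> D 0 ` free_module (R (Suc 0))"
        unfolding resJ(3) using ap(2) by (simp add: single_in_unit_module)
      then obtain g where g: "g \<in> free_module (R (Suc 0))" "Poly_Mapping.single (0, 0) a = D 0 g" by (rule imageE)
      let ?w = "Poly_Mapping.single (0, 0) p :: ('n, 'k) fmod"
      have w: "?w \<in> free_module (Q 0)" unfolding resP(1) by (rule single_in_unit_module)
      have "v = Poly_Mapping.single (0, 0) (a + u * y * p)"
        using unit_module_eq_single[of v] v unfolding ap(1) by blast
      also have "\<dots> = Poly_Mapping.single (0, 0) a + fscale y (fscale u ?w)"
        by (simp only: single_add fscale_single mult.assoc mult.left_commute)
      also have "\<dots> = D' 0 (g + ?I 0 ?w)"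
        unfolding D'_eq[OF g(1)] g(2) \<phi>(1) by (simp only: low_def nat.case diff_zero)
      finally have eq: "v = D' 0 (g + ?I 0 ?w)" .
      have "g + ?I 0 ?w \<in> free_module (?R' (Suc 0))"
        using free_module_add[OF left_in_sum[OF g(1)] inj_right_in[OF w]] by (simp only: nat.case)
      with eq show "v \<in> ?l" by (rule image_eqI)
    qed
  qed

  have exact: "D' (Suc i) ` free_module (?R' (Suc (Suc i))) = {v \<in> free_module (?R' (Suc i)). D' i v = 0}"
    (is "?l = ?r") for i
  proof
    show "?l \<subseteq> ?r"
    proof (rule image_subsetI)
      fix v :: "('n, 'k) fmod" assume v: "v \<in> free_module (?R' (Suc (Suc i)))"
      then have "v \<in> free_module (sum_rank (R (Suc (Suc i))) (Q (Suc i)) ?d)" by simp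
      then obtain g w where gw: "g \<in> free_module (R (Suc (Suc i)))" "w \<in> free_module (Q (Suc i))"
          "v = g + ?I (Suc i) w"
        by (rule sumE)
      let ?g = "D (Suc i) g + fscale y (\<phi> (Suc i) w)" and ?w = "- E i w"
      have g': "?g \<in> free_module (R (Suc i))" by (rule main_in[OF gw(1,2)])
      have "D' (Suc i) v = ?g + ?I i ?w"
        unfolding gw(3) D'_eq[OF gw(1)]
        by (simp add: low_def module_hom.neg[OF fhom_inj_right])
      then have "D' i (D' (Suc i) v) = (D i ?g + fscale y (\<phi> i ?w)) - low i ?w"
        using D'_eq[OF g'] by simp
      moreover have "D i ?g = fscale y (\<phi> i (E i w))"
        using resolves_complex[OF J gw(1)] \<phi>(3)[OF gw(2)]
        by (simp add: module_hom.add[OF homD] module_hom.scale[OF homD])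
      moreover have "low i (E i w) = 0"
      proof (cases i)
        case (Suc i')
        then have "E i' (E i w) = 0" using resolves_complex[OF P] gw(2) by simp
        then show ?thesis by (simp add: low_def Suc module_hom.zero[OF fhom_inj_right])
      qed (simp add: low_def)
      ultimately have "D' i (D' (Suc i) v) = 0"
        by (simp add: module_hom.neg[OF hom\<phi>] module_hom.neg[OF hom_low] module_hom.neg[OF fhom_fscale])
      then show "D' (Suc i) v \<in> ?r" using graded_homD(2)[OF gr v] by simp
    qed
    show "?r \<subseteq> ?l"
    proof
      fix v :: "('n, 'k) fmod" assume v: "v \<in> ?r"
      then have "v \<in> free_module (sum_rank (R (Suc i)) (Q i) ?d)" by simp
      then obtain g w where gw: "g \<in> free_module (R (Suc i))" "w \<in> free_module (Q i)" "v = g + ?I i w"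
        by (rule sumE)
      have zero: "(D i g + fscale y (\<phi> i w)) - low i w = 0"
        using v D'_eq[OF gw(1)] gw(3) by simp
      \<comment> \<open>this is where the colon condition enters in position \<open>0\<close>, and exactness of \<open>E\<close> in the others\<close>
      have "D i g + fscale y (\<phi> i w) = 0 \<and> w \<in> E i ` free_module (Q (Suc i))"
      proof (cases i)
        case 0
        have eq: "D 0 g + fscale y (fscale u w) = 0" using zero by (simp add: 0 low_def \<phi>(1))
        have "lookup (D 0 g) (0, 0) \<in> J" using resJ(3) gw(1) 0 by blast
        moreover have "lookup (D 0 g) (0, 0) = u * y * lookup (- w) (0, 0)"
        proof -
          have "lookup (D 0 g) (0, 0) + y * (u * lookup w (0, 0)) = 0"
            using arg_cong[OF eq, of "\<lambda>v. lookup v (0, 0)"]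
            by (simp only: lookup_add lookup_fscale lookup_zero)
          then have "lookup (D 0 g) (0, 0) = - (y * (u * lookup w (0, 0)))"
            by (simp only: eq_neg_iff_add_eq_0)
          then show ?thesis by (simp only: lookup_uminus mult_minus_right mult.assoc mult.left_commute)
        qed
        ultimately have "lookup (- w) (0, 0) \<in> P" using colon by simp
        moreover have "- w \<in> free_module unit_rank"
          using gw(2) 0 resP(1) fm.subspace_neg[OF subspace_free_module] by metis
        ultimately have "- w \<in> E 0 ` free_module (Q (Suc 0))" unfolding resP(3) by blast
        then obtain w' where w': "w' \<in> free_module (Q (Suc 0))" "- w = E 0 w'" by (rule imageE)
        then have "w = E 0 (- w')" by (simp add: module_hom.neg[OF homE] minus_equation_iff[of w] eq_commute)
        then have "w \<in> E 0 ` free_module (Q (Suc 0))"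
          using fm.subspace_neg[OF subspace_free_module w'(1)] by (rule image_eqI)
        then show ?thesis using eq 0 \<phi>(1) by simp
      next
        case (Suc i')
        let ?m = "D i g + fscale y (\<phi> i w)"
        have m: "?m \<in> free_module (R (Suc i'))" using main_in[OF gw(1,2)] Suc by simp
        have "?m - ?I i' (E i' w) = 0" using zero by (simp add: low_def Suc)
        then have eq: "?m = ?I i' (E i' w)" by simp
        have "?R i' ?m = 0" by (rule proj_right_free_module[OF m])
        then have "E i' w = 0" unfolding eq proj_right_inj_right .
        then have "?m = 0" "w \<in> E i ` free_module (Q (Suc i))"
          using eq gw(2) resP(4)[of i'] by (simp_all add: module_hom.zero[OF fhom_inj_right] Suc)
        then show ?thesis by blast
      qed
      then obtain w' where D0: "D i g + fscale y (\<phi> i w) = 0" and w': "w' \<in> free_module (Q (Suc i))" "w = E i w'"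
        by blast
      \<comment> \<open>correcting \<open>g\<close> by the lift of \<open>w'\<close> makes it a cycle, hence a boundary\<close>
      let ?g = "g + fscale y (\<phi> (Suc i) w')"
      have "D i ?g = 0"
        using D0 \<phi>(3)[OF w'(1)] w'(2) by (simp add: module_hom.add[OF homD] module_hom.scale[OF homD])
      moreover have "?g \<in> free_module (R (Suc i))"
        by (intro free_module_add free_module_fscale gw(1) graded_homD(2)[OF \<phi>(2) w'(1)])
      ultimately have "?g \<in> D (Suc i) ` free_module (R (Suc (Suc i)))" unfolding resJ(4) by simp
      then obtain g' where g': "g' \<in> free_module (R (Suc (Suc i)))" "?g = D (Suc i) g'" by (rule imageE)
      have "v = D' (Suc i) (g' + ?I (Suc i) (- w'))"
        unfolding D'_eq[OF g'(1)] g'(2)[symmetric]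
        by (simp add: gw(3) w'(2) low_def module_hom.neg[OF hom\<phi>] module_hom.neg[OF homE]
            module_hom.neg[OF fhom_inj_right] module_hom.neg[OF fhom_fscale])
      moreover have "g' + ?I (Suc i) (- w') \<in> free_module (?R' (Suc (Suc i)))"
        using left_in_sum[OF g'(1)] inj_right_in[OF fm.subspace_neg[OF subspace_free_module w'(1)]]
        by (simp add: free_module_add)
      ultimately show "v \<in> ?l" by (rule image_eqI)
    qed
  qed

  have E_max: "in_max_submodule (E i w)" if w: "w \<in> free_module (Q (Suc i))" for i w
  proof (cases i)
    case 0
    have "E 0 w \<in> {v \<in> free_module unit_rank. lookup v (0, 0) \<in> P}" using resP(3) w 0 by blast
    then have "lookup (lookup (E 0 w) (0, 0)) 0 = 0" and "E 0 w \<in> free_module unit_rank" using P_max by auto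
    have "lookup (lookup (E 0 w) b) 0 = 0" for b
      by (subst unit_module_eq_single[OF \<open>E 0 w \<in> free_module unit_rank\<close>])
        (auto simp: lookup_single when_def \<open>lookup (lookup (E 0 w) (0, 0)) 0 = 0\<close>)
    then show ?thesis by (simp add: in_max_submodule_def 0)
  next
    case (Suc i')
    then show ?thesis using resP(5) w by simp
  qed
  have y0: "lookup y 0 = 0"
  proof (rule ccontr)
    assume "lookup y 0 \<noteq> 0"
    then have "0 \<in> keys y" by (simp add: in_keys_iff)
    then have "mono_degree (0 :: 'n \<Rightarrow>\<^sub>0 nat) = 1" using y unfolding homogeneous_def by blast
    then show False by (simp add: mono_degree_def)
  qed
  have min: "in_max_submodule (D' (Suc i) v)" if "v \<in> free_module (?R' (Suc (Suc i)))" for i v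
  proof -
    have "v \<in> free_module (sum_rank (R (Suc (Suc i))) (Q (Suc i)) ?d)" using that by simp
    then obtain g w where gw: "g \<in> free_module (R (Suc (Suc i)))" "w \<in> free_module (Q (Suc i))"
        "v = g + ?I (Suc i) w"
      by (rule sumE)
    have "in_max_submodule (D (Suc i) g)" by (rule resJ(5)[OF gw(1)])
    moreover have "in_max_submodule (fscale y (\<phi> (Suc i) w))"
      by (simp add: in_max_submodule_def lookup_fscale lookup_mult_zero y0)
    moreover have "in_max_submodule (low (Suc i) w)"
      using in_max_fhom[OF fhom_inj_right E_max[OF gw(2)]] by (simp add: low_def)
    ultimately show ?thesis
      unfolding gw(3) D'_eq[OF gw(1)]
      by (simp add: in_max_submodule_def lookup_add lookup_minus)
  qed
  have "resolves {a + u * y * p | a p. a \<in> J} ?R' D'"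
    unfolding resolves_def using gr im0 exact min resJ(1) by simp
  then show ?thesis by (intro exI[of _ D'])
qed

section \<open>Squarefree monomial ideals\<close>

definition set_exponent :: "'n::finite set \<Rightarrow> ('n \<Rightarrow>\<^sub>0 nat)" where
  "set_exponent F = (\<Sum>i\<in>F. Poly_Mapping.single i 1)"

lemma lookup_set_exponent: "lookup (set_exponent F) i = (1 when i \<in> F)"
  unfolding set_exponent_def lookup_sum lookup_single when_def by simp

lemma keys_set_exponent [simp]: "keys (set_exponent F) = F"
  by (auto simp: in_keys_iff lookup_set_exponent when_def split: if_splits)

lemma mono_degree_set_exponent: "mono_degree (set_exponent F) = card F"
  by (simp add: mono_degree_def lookup_set_exponent when_def flip: sum.inter_filter)

lemma keys_nat_add: "keys (a + b :: 'n \<Rightarrow>\<^sub>0 nat) = keys a \<union> keys b"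
  by (auto simp: in_keys_iff lookup_add)

lemma card_keys_le_degree: "card (keys m) \<le> mono_degree m"
proof -
  have "card (keys m) = (\<Sum>i\<in>keys m. 1)" by simp
  also have "\<dots> \<le> (\<Sum>i\<in>keys m. lookup m i)"
    by (rule sum_mono) (simp add: in_keys_iff Suc_le_eq)
  also have "\<dots> \<le> mono_degree m"
    unfolding mono_degree_def by (rule sum_mono2) auto
  finally show ?thesis .
qed

lemma prod_variable:
  fixes F :: "'n::finite set"
  shows "(\<Prod>i\<in>F. variable i :: ('n, 'k::field) mpoly) = Poly_Mapping.single (set_exponent F) 1"
proof -
  have "finite F" by simp
  then show ?thesis
    by (induction F rule: finite_induct) (simp_all add: set_exponent_def variable_def mult_single)
qed

text \<open>
  A polynomial lies in a monomial ideal iff each of its monomials does, and a monomial is divisible by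
  \<open>x_F\<close> iff \<open>F\<close> is contained in its support. This reduces all ideal-theoretic conditions to
  inclusions of sets.
\<close>
lemma in_circuit_ideal_iff:
  fixes p :: "('n::finite, 'k::field) mpoly"
  shows "p \<in> circuit_ideal D \<longleftrightarrow> (\<forall>m\<in>keys p. \<exists>F\<in>D. F \<subseteq> keys m)"
proof
  let ?x = "\<lambda>F. \<Prod>i\<in>F. variable i :: ('n, 'k) mpoly"
  let ?S = "{p :: ('n, 'k) mpoly. \<forall>m\<in>keys p. \<exists>F\<in>D. F \<subseteq> keys m}"
  have "pm.subspace ?S"
  proof (rule pm.subspaceI)
    fix p q :: "('n, 'k) mpoly" assume "p \<in> ?S" "q \<in> ?S"
    then show "p + q \<in> ?S" using keys_add[of p q] by blast
  next
    fix r p :: "('n, 'k) mpoly" assume p: "p \<in> ?S"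
    show "r * p \<in> ?S"
    proof (rule CollectI, rule ballI)
      fix m assume "m \<in> keys (r * p)"
      then obtain a b where ab: "a \<in> keys r" "b \<in> keys p" "m = a + b" by (rule keys_multE)
      then obtain F where "F \<in> D" "F \<subseteq> keys b" using p by blast
      then show "\<exists>F\<in>D. F \<subseteq> keys m" unfolding ab(3) keys_nat_add by blast
    qed
  qed simp
  moreover have "?x ` D \<subseteq> ?S" by (auto simp: prod_variable)
  ultimately have "circuit_ideal D \<subseteq> ?S" unfolding circuit_ideal_def by (rule pm.span_minimal[rotated])
  then show "p \<in> circuit_ideal D \<Longrightarrow> \<forall>m\<in>keys p. \<exists>F\<in>D. F \<subseteq> keys m" by blast
next
  assume p: "\<forall>m\<in>keys p. \<exists>F\<in>D. F \<subseteq> keys m"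
  let ?x = "\<lambda>F. \<Prod>i\<in>F. variable i :: ('n, 'k) mpoly"
  have "(\<Sum>m\<in>keys p. Poly_Mapping.single m (lookup p m)) \<in> circuit_ideal D"
    unfolding circuit_ideal_def
  proof (rule pm.span_sum)
    fix m assume "m \<in> keys p"
    then obtain F where F: "F \<in> D" "F \<subseteq> keys m" using p by blast
    have m: "m = (m - set_exponent F) + set_exponent F"
    proof (rule poly_mapping_eqI)
      fix i
      have "i \<in> F \<Longrightarrow> lookup m i \<noteq> 0" using F(2) by (auto simp: in_keys_iff)
      then show "lookup m i = lookup (m - set_exponent F + set_exponent F) i"
        by (cases "i \<in> F") (simp_all add: lookup_add lookup_minus lookup_set_exponent)
    qed
    have "Poly_Mapping.single m (lookup p m) = Poly_Mapping.single (m - set_exponent F) (lookup p m) * ?x F"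
      unfolding prod_variable mult_single by (subst m) simp
    also have "\<dots> \<in> pm.span (?x ` D)" by (intro pm.span_scale pm.span_base imageI F(1))
    finally show "Poly_Mapping.single m (lookup p m) \<in> pm.span (?x ` D)" .
  qed
  also have "(\<Sum>m\<in>keys p. Poly_Mapping.single m (lookup p m)) = p"
    by (rule poly_mapping_sum_singles)
  finally show "p \<in> circuit_ideal D" .
qed

lemma circuit_ideal_resolution_exists: "\<exists>R \<Delta>. resolves (circuit_ideal D :: ('n::finite, 'k::field) mpoly set) R \<Delta>"
proof (rule minimal_resolution_exists)
  show "pm.subspace (circuit_ideal D :: ('n, 'k) mpoly set)"
    unfolding circuit_ideal_def by (rule pm.subspace_span)
  fix p :: "('n, 'k) mpoly" and t assume p: "p \<in> circuit_ideal D"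
  have "keys (lookup (hcomp t (Poly_Mapping.single (0, 0) p)) (0, 0)) \<subseteq> keys p"
    by (auto simp: in_keys_iff lookup_hcomp)
  then show "lookup (hcomp t (Poly_Mapping.single (0, 0) p)) (0, 0) \<in> circuit_ideal D"
    using p unfolding in_circuit_ideal_iff by blast
qed

text \<open>
  The mapping cone for \<open>u = x_e\<close> and \<open>y = x_c\<close>. The hypothesis that all members of \<open>D\<close> meet \<open>V\<close>,
  whereas \<open>e \<union> {c}\<close> does not, gives \<open>J : x_e x_c \<subseteq> P_V\<close>; the last hypothesis gives
  \<open>x_e P_V \<subseteq> J\<close>.
\<close>
lemma add_circuit_resolution:
  fixes D :: "'n::finite set set"
  assumes J: "resolves (circuit_ideal D :: ('n, 'k::field) mpoly set) R \<Delta>"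
    and P: "resolves (circuit_ideal ((\<lambda>v. {v}) ` V) :: ('n, 'k) mpoly set) Q E"
    and c: "c \<notin> e" and V: "V \<inter> insert c e = {}"
    and meet: "\<And>G. G \<in> D \<Longrightarrow> G \<inter> V \<noteq> {}"
    and contain: "\<And>v. v \<in> V \<Longrightarrow> \<exists>G\<in>D. G \<subseteq> insert v e"
  shows "\<exists>\<Delta>'. resolves (circuit_ideal (insert (insert c e) D) :: ('n, 'k) mpoly set)
     (case_nat (R 0) (\<lambda>i. sum_rank (R (Suc i)) (Q i) (Suc (card e)))) \<Delta>'"
proof -
  let ?x = "\<lambda>F. \<Prod>i\<in>F. variable i :: ('n, 'k) mpoly"
  let ?J = "circuit_ideal D :: ('n, 'k) mpoly set"
  have uy: "?x e * variable c = ?x (insert c e)" using c by (simp add: mult.commute)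
  have "\<exists>\<Delta>'. resolves {a + ?x e * variable c * p | a p. a \<in> ?J}
     (case_nat (R 0) (\<lambda>i. sum_rank (R (Suc i)) (Q i) (Suc (card e)))) \<Delta>'"
  proof (rule mapping_cone_resolution[OF P J])
    show "homogeneous (card e) (?x e)"
      using homogeneous_monomial[of "set_exponent e" 1] by (simp add: prod_variable mono_degree_set_exponent)
    show "homogeneous 1 (variable c :: ('n, 'k) mpoly)"
    proof -
      have "variable c = ?x {c}" by simp
      also have "homogeneous (card {c}) \<dots>"
        unfolding prod_variable mono_degree_set_exponent[symmetric] by (rule homogeneous_monomial)
      finally show ?thesis by simp
    qed
  next
    fix p :: "('n, 'k) mpoly" assume p: "p \<in> circuit_ideal ((\<lambda>v. {v}) ` V)"
    show "?x e * p \<in> circuit_ideal D"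
      unfolding in_circuit_ideal_iff
    proof
      fix m assume "m \<in> keys (?x e * p)"
      then obtain b where b: "b \<in> keys p" "m = set_exponent e + b"
        unfolding prod_variable by (elim keys_multE) simp
      then obtain v where v: "v \<in> V" "v \<in> keys b" using p unfolding in_circuit_ideal_iff by blast
      then obtain G where "G \<in> D" "G \<subseteq> insert v e" using contain by blast
      then show "\<exists>F\<in>D. F \<subseteq> keys m" using v(2) unfolding b(2) keys_nat_add keys_set_exponent by blast
    qed
    show "lookup p 0 = 0"
    proof (rule ccontr)
      assume "lookup p 0 \<noteq> 0"
      then have "0 \<in> keys p" by (simp add: in_keys_iff)
      then show False using p unfolding in_circuit_ideal_iff by fastforce
    qed
  next
    fix p :: "('n, 'k) mpoly" assume p: "?x e * variable c * p \<in> circuit_ideal D"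
    show "p \<in> circuit_ideal ((\<lambda>v. {v}) ` V)"
      unfolding in_circuit_ideal_iff
    proof
      fix m assume m: "m \<in> keys p"
      have "set_exponent (insert c e) + m \<in> keys (?x e * variable c * p)"
        using m unfolding uy unfolding prod_variable in_keys_iff lookup_monomial_mult by simp
      then have "\<exists>G\<in>D. G \<subseteq> keys (set_exponent (insert c e) + m)"
        using p unfolding in_circuit_ideal_iff by (rule bspec[rotated])
      then obtain G where G: "G \<in> D" "G \<subseteq> insert c e \<union> keys m"
        unfolding keys_nat_add keys_set_exponent by (rule bexE)
      obtain v where "v \<in> G" "v \<in> V" using meet[OF G(1)] by blast
      then have "v \<in> keys m" using G(2) V by blast
      then show "\<exists>F\<in>(\<lambda>v. {v}) ` V. F \<subseteq> keys m" using \<open>v \<in> V\<close> by blast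
    qed
  qed
  moreover have "{a + ?x e * variable c * p | a p. a \<in> ?J} = circuit_ideal (insert (insert c e) D)"
  proof -
    have "circuit_ideal (insert (insert c e) D) = {q. \<exists>k. q - k * ?x (insert c e) \<in> ?J}"
      unfolding circuit_ideal_def image_insert by (rule pm.span_insert)
    also have "\<dots> = {a + ?x (insert c e) * p | a p. a \<in> ?J}"
    proof (intro set_eqI iffI)
      fix q assume "q \<in> {q. \<exists>k. q - k * ?x (insert c e) \<in> ?J}"
      then obtain k where "q - k * ?x (insert c e) \<in> ?J" by blast
      moreover have "q = (q - k * ?x (insert c e)) + ?x (insert c e) * k" by (simp add: mult.commute)
      ultimately show "q \<in> {a + ?x (insert c e) * p | a p. a \<in> ?J}" by blast
    next
      fix q assume "q \<in> {a + ?x (insert c e) * p | a p. a \<in> ?J}"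
      then obtain a p where "q = a + ?x (insert c e) * p" "a \<in> ?J" by blast
      then have "q - p * ?x (insert c e) \<in> ?J" by (simp add: mult.commute)
      then show "q \<in> {q. \<exists>k. q - k * ?x (insert c e) \<in> ?J}" by blast
    qed
    finally show ?thesis by (simp only: uy)
  qed
  ultimately show ?thesis by simp
qed

lemma zero_ideal_resolution:
  "resolves (circuit_ideal {} :: ('n::finite, 'k::field) mpoly set)
     (case_nat unit_rank (\<lambda>i j. 0)) (\<lambda>i v. 0)"
proof -
  have free0: "free_module (\<lambda>j. 0) = ({0} :: ('n, 'k) fmod set)"
  proof
    show "free_module (\<lambda>j. 0) \<subseteq> ({0} :: ('n, 'k) fmod set)"
      by (force simp: in_free_module_iff intro!: poly_mapping_eqI)
  qed (simp add: free_module_zero)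
  have I0: "circuit_ideal {} = ({0} :: ('n, 'k) mpoly set)"
    by (simp add: circuit_ideal_def)
  have unit0: "{v \<in> free_module unit_rank. lookup v (0, 0) \<in> circuit_ideal {}} = ({0} :: ('n, 'k) fmod set)"
  proof
    show "{v \<in> free_module unit_rank. lookup v (0, 0) \<in> circuit_ideal {}} \<subseteq> ({0} :: ('n, 'k) fmod set)"
    proof
      fix v :: "('n, 'k) fmod" assume "v \<in> {v \<in> free_module unit_rank. lookup v (0, 0) \<in> circuit_ideal {}}"
      then show "v \<in> {0}" using unit_module_eq_single[of v] by (simp add: I0)
    qed
  qed (simp add: I0 free_module_zero)
  show ?thesis
    unfolding resolves_def using unit0
    by (simp add: graded_hom_zero free0 in_max_submodule_def)
qed

text \<open>
  The ranks are those of the Koszul complex, which is obtained by adjoining the variables one at a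
  time: adding \<open>x_c\<close> to \<open>P_V\<close> is the case \<open>e = {}\<close> of the mapping cone, since \<open>P_V : x_c = P_V\<close>.
\<close>
lemma variable_ideal_linear_resolution:
  fixes V :: "'n::finite set"
  shows "\<exists>Q E. resolves (circuit_ideal ((\<lambda>v. {v}) ` V) :: ('n, 'k::field) mpoly set) Q E \<and>
     (\<forall>i j. Q i j \<noteq> 0 \<longrightarrow> j = i)"
proof -
  have "finite V" by simp
  then show ?thesis
  proof (induction V rule: finite_induct)
    case empty
    let ?Q = "case_nat unit_rank (\<lambda>i j. 0 :: nat)"
    have "?Q i j \<noteq> 0 \<longrightarrow> j = i" for i j by (cases i) (simp_all add: unit_rank_def)
    then show ?case using zero_ideal_resolution by (simp only: image_empty) blast
  next
    case (insert c V)
    then obtain Q E where QE: "resolves (circuit_ideal ((\<lambda>v. {v}) ` V) :: ('n, 'k) mpoly set) Q E"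
      "\<And>i j. Q i j \<noteq> 0 \<Longrightarrow> j = i" by blast
    let ?Q = "case_nat (Q 0) (\<lambda>i. sum_rank (Q (Suc i)) (Q i) (Suc (card ({} :: 'n set))))"
    have "\<exists>E'. resolves (circuit_ideal (insert (insert c {}) ((\<lambda>v. {v}) ` V)) :: ('n, 'k) mpoly set) ?Q E'"
      by (rule add_circuit_resolution[OF QE(1) QE(1)]) (use insert.hyps in auto)
    moreover have "?Q i j \<noteq> 0 \<longrightarrow> j = i" for i j
    proof (cases i)
      case 0
      then show ?thesis using QE(2) by simp
    next
      case (Suc i')
      show ?thesis
        using QE(2)[of i j] QE(2)[of i' "j - 1"] by (auto simp: Suc sum_rank_def split: if_splits)
    qed
    ultimately show ?case by (simp only: image_insert) blast
  qed
qed

text \<open>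
  A generator \<open>x_F\<close> has degree \<open>d\<close>, and \<open>I\<close> contains nothing of smaller degree. The basis elements
  of degree less than \<open>d\<close> are therefore mapped to \<open>0\<close>, so \<open>x_F\<close> needs one of degree \<open>d\<close>.
\<close>
lemma generator_rank_nonzero:
  fixes D :: "'n::finite set set"
  assumes res: "resolves (circuit_ideal D :: ('n, 'k::field) mpoly set) R \<Delta>"
    and d: "\<And>F. F \<in> D \<Longrightarrow> card F = d" and F: "F \<in> D"
  shows "R (Suc 0) d \<noteq> 0"
proof
  assume R0: "R (Suc 0) d = 0"
  note resD = resolvesD[OF res] and hom = graded_homD[OF resolvesD(2)[OF res]]
  let ?s = "Poly_Mapping.single (0, 0) (Poly_Mapping.single (set_exponent F) 1) :: ('n, 'k) fmod"
  have "?s \<in> \<Delta> 0 ` free_module (R (Suc 0))"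
    unfolding resD(3) using F by (auto simp: single_in_unit_module in_circuit_ideal_iff)
  then obtain w where w: "w \<in> free_module (R (Suc 0))" "?s = \<Delta> 0 w" by (rule imageE)
  let ?w = "hcomp d w"
  have w': "?w \<in> free_module (R (Suc 0))" "fhomogeneous d ?w"
    by (simp_all add: hcomp_free_module[OF w(1)] fhomogeneous_hcomp)
  have "fhomogeneous d ?s"
    unfolding fhomogeneous_single
    using homogeneous_monomial[of "set_exponent F"] d[OF F] by (simp add: mono_degree_set_exponent)
  then have s: "?s = \<Delta> 0 ?w"
    using graded_hom_hcomp[OF resD(2) w(1), of d] w(2)[symmetric] hcomp_fhomogeneous[of d ?s d] by simp
  have "\<Delta> 0 (basis_vec b) = 0" if b: "b \<in> keys ?w" for b
  proof -
    obtain j k where jk: "b = (j, k)" by (cases b)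
    have nz: "lookup ?w (j, k) \<noteq> 0" using b jk by (simp add: in_keys_iff)
    have k: "k < R (Suc 0) j" using nz w'(1) unfolding in_free_module_iff by blast
    have "j < d"
      using homogeneous_coefficient(1)[OF w'(2) nz] k R0 by (cases "j = d") auto
    have bF: "basis_vec (j, k) \<in> free_module (R (Suc 0))" using k by (rule basis_vec_in_free_module)
    let ?v = "\<Delta> 0 (basis_vec (j, k))"
    have "?v \<in> {v \<in> free_module unit_rank. lookup v (0, 0) \<in> circuit_ideal D}"
      using resD(3) bF by blast
    then have v: "?v \<in> free_module unit_rank" "lookup ?v (0, 0) \<in> circuit_ideal D" by blast+
    have "fhomogeneous j ?v" using hom(3)[OF bF fhomogeneous_basis_vec] by simp
    then have hj: "homogeneous j (lookup ?v (0, 0))"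
      using unit_module_eq_single[OF v(1)] fhomogeneous_single by metis
    have "lookup ?v (0, 0) = 0"
    proof (rule poly_mapping_eqI, rule ccontr)
      fix m assume "lookup (lookup ?v (0, 0)) m \<noteq> lookup 0 m"
      then have m: "m \<in> keys (lookup ?v (0, 0))" by (simp add: in_keys_iff)
      then obtain G where G: "G \<in> D" "G \<subseteq> keys m" using v(2) unfolding in_circuit_ideal_iff by blast
      have "d \<le> card (keys m)" using d[OF G(1)] card_mono[OF _ G(2)] by simp
      also have "\<dots> \<le> mono_degree m" by (rule card_keys_le_degree)
      also have "\<dots> = j" using hj m unfolding homogeneous_def by blast
      finally show False using \<open>j < d\<close> by simp
    qed
    then show ?thesis using unit_module_eq_single[OF v(1)] jk by simp
  qed
  then have "\<Delta> 0 ?w = 0"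
    unfolding fhom_expand[where v = ?w, OF hom(1)] by simp
  then have "?s = 0" using s by simp
  then have "lookup (lookup ?s (0, 0)) (set_exponent F) = 0" by (simp only: lookup_zero)
  then show False by simp
qed

section \<open>Deleting a simplicial submaximal circuit\<close>

lemma complement_of_deletion:
  fixes C :: "'n::finite set set"
  assumes "uniform_clutter d C" and "card e + 1 = d"
  shows "clutter_complement d (clutter_deletion C e) =
    clutter_complement d C \<union> (\<lambda>c. insert c e) ` (closed_nbhd C e - e)"
proof (intro set_eqI iffI)
  fix F assume F: "F \<in> clutter_complement d (clutter_deletion C e)"
  then have cF: "card F = d" by (simp add: clutter_complement_def complete_clutter_def)
  show "F \<in> clutter_complement d C \<union> (\<lambda>c. insert c e) ` (closed_nbhd C e - e)"
  proof (cases "F \<in> C")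
    case False
    then show ?thesis using cF by (simp add: clutter_complement_def complete_clutter_def)
  next
    case True
    then have e: "e \<subseteq> F" using F by (auto simp: clutter_complement_def clutter_deletion_def)
    then have "card (F - e) = 1" using cF assms(2) by (simp add: card_Diff_subset)
    then obtain c where "F - e = {c}" by (rule card_1_singletonE)
    then have c: "F = insert c e" "c \<notin> e" using e by auto
    then have "c \<in> closed_nbhd C e - e" using True by (simp add: closed_nbhd_def)
    then show ?thesis using c by blast
  qed
next
  fix F assume "F \<in> clutter_complement d C \<union> (\<lambda>c. insert c e) ` (closed_nbhd C e - e)"
  then show "F \<in> clutter_complement d (clutter_deletion C e)"
  proof
    assume "F \<in> clutter_complement d C"
    then show ?thesis by (auto simp: clutter_complement_def clutter_deletion_def)
  next
    assume "F \<in> (\<lambda>c. insert c e) ` (closed_nbhd C e - e)"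
    then obtain c where c: "F = insert c e" "c \<in> closed_nbhd C e" "c \<notin> e" by blast
    then have "card F = d" using assms(2) by simp
    then show ?thesis
      using c by (auto simp: clutter_complement_def clutter_deletion_def complete_clutter_def)
  qed
qed

text \<open>
  Induction over the set \<open>A\<close> of vertices already treated. When \<open>c\<close> is added, the colon ideal is
  generated by the variables outside \<open>N[e]\<close> and those in \<open>A\<close>. The cone adds the ranks \<open>Q i\<close> of a
  linear resolution, shifted by \<open>d\<close>, so only degree \<open>i + d\<close> is affected.
\<close>
lemma betti_support_of_deletion:
  fixes C :: "'n::finite set set"
  assumes simp: "simplicial d C e" and d: "card e + 1 = d"
    and res: "resolves (circuit_ideal (clutter_complement d C) :: ('n, 'k::field) mpoly set) R \<Delta>"
    and A: "A \<subseteq> closed_nbhd C e - e"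
  shows "\<exists>R' \<Delta>'. resolves (circuit_ideal (clutter_complement d C \<union> (\<lambda>c. insert c e) ` A) :: ('n, 'k) mpoly set) R' \<Delta>' \<and>
    (\<forall>i j. j \<noteq> i + d \<longrightarrow> R' (Suc i) j = R (Suc i) j)"
proof -
  have "finite A" by simp
  then show ?thesis using A
  proof (induction A rule: finite_induct)
    case empty
    then show ?case using res by auto
  next
    case (insert c A)
    let ?D = "clutter_complement d C \<union> (\<lambda>c. insert c e) ` A"
    obtain R' \<Delta>' where R': "resolves (circuit_ideal ?D :: ('n, 'k) mpoly set) R' \<Delta>'"
      "\<And>i j. j \<noteq> i + d \<Longrightarrow> R' (Suc i) j = R (Suc i) j"
      using insert by blast
    let ?V = "- closed_nbhd C e \<union> A"
    obtain Q E where Q: "resolves (circuit_ideal ((\<lambda>v. {v}) ` ?V) :: ('n, 'k) mpoly set) Q E"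
      "\<And>i j. Q i j \<noteq> 0 \<Longrightarrow> j = i"
      using variable_ideal_linear_resolution[of ?V, where 'k = 'k] by blast
    have e_nbhd: "e \<subseteq> closed_nbhd C e" by (simp add: closed_nbhd_def)
    let ?R = "case_nat (R' 0) (\<lambda>i. sum_rank (R' (Suc i)) (Q i) (Suc (card e)))"
    have "\<exists>\<Delta>''. resolves (circuit_ideal (insert (insert c e) ?D) :: ('n, 'k) mpoly set) ?R \<Delta>''"
    proof (rule add_circuit_resolution[OF R'(1) Q(1)])
      show "c \<notin> e" using insert.prems by blast
      show "?V \<inter> insert c e = {}" using insert.hyps insert.prems e_nbhd by blast
      show "G \<inter> ?V \<noteq> {}" if "G \<in> ?D" for G
        using that
      proof
        assume G: "G \<in> clutter_complement d C"
        then have "card G = d" "G \<notin> C" by (simp_all add: clutter_complement_def complete_clutter_def)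
        then have "\<not> G \<subseteq> closed_nbhd C e" using simp by (auto simp: simplicial_def clique_def)
        then show ?thesis by blast
      qed blast
      show "\<exists>G\<in>?D. G \<subseteq> insert v e" if "v \<in> ?V" for v
        using that
      proof
        assume v: "v \<in> - closed_nbhd C e"
        then have "insert v e \<notin> C" "v \<notin> e" by (auto simp: closed_nbhd_def)
        then have "insert v e \<in> clutter_complement d C"
          using d by (simp add: clutter_complement_def complete_clutter_def)
        then show ?thesis by blast
      qed blast
    qed
    moreover have "insert (insert c e) ?D = clutter_complement d C \<union> (\<lambda>c. insert c e) ` insert c A" by simp
    moreover have "?R (Suc i) j = R (Suc i) j" if "j \<noteq> i + d" for i j
    proof -
      have "Q i (j - d) = 0" if "d \<le> j"
        using Q(2)[of i "j - d"] \<open>j \<noteq> i + d\<close> that by (cases "Q i (j - d) = 0") auto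
      then show ?thesis using R'(2)[OF that] d by (auto simp: sum_rank_def)
    qed
    ultimately show ?case by (simp only:) blast
  qed
qed

theorem theorem3p7:
  fixes d :: nat and C C' :: "'n::finite set set" and e :: "'n set"
    and I J :: "('n, 'k::field) mpoly set"
  assumes "1 \<le> d" and "d \<le> CARD('n)"
    and "uniform_clutter d C" and "C \<noteq> complete_clutter d"
    and "simplicial d C e"
    and "C' = clutter_deletion C e"
    and "I = circuit_ideal (clutter_complement d C)"
    and "J = circuit_ideal (clutter_complement d C')"
  shows "regularity I = regularity J"
proof -
  have "card e = d - 1" using assms(5) by (simp add: simplicial_def submaximal_circuit_def)
  then have d: "card e + 1 = d" using assms(1) by simp
  obtain R \<Delta> where R: "resolves I R \<Delta>"
    unfolding assms(7) using circuit_ideal_resolution_exists by blast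
  obtain R' \<Delta>' where R': "resolves J R' \<Delta>'"
    and eq: "\<And>i j. j \<noteq> i + d \<Longrightarrow> R' (Suc i) j = R (Suc i) j"
    using betti_support_of_deletion[OF assms(5) d R[unfolded assms(7)] order_refl]
    unfolding assms(6,8) complement_of_deletion[OF assms(3) d] by blast
  have "C \<subseteq> complete_clutter d" using assms(3) by (auto simp: uniform_clutter_def complete_clutter_def)
  then obtain F where F: "F \<in> clutter_complement d C" using assms(4) by (auto simp: clutter_complement_def)
  then have F': "F \<in> clutter_complement d C'"
    by (auto simp: assms(6) clutter_complement_def clutter_deletion_def)
  have card: "\<And>G. G \<in> clutter_complement d B \<Longrightarrow> card G = d" for B :: "'n set set"
    by (simp add: clutter_complement_def complete_clutter_def)
  have gens: "R (Suc 0) d \<noteq> 0" "R' (Suc 0) d \<noteq> 0"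
    using generator_rank_nonzero[OF R[unfolded assms(7)] card F]
      generator_rank_nonzero[OF R'[unfolded assms(8)] card F'] by simp_all
  \<comment> \<open>a place \<open>(i, i + d)\<close> yields the value \<open>d\<close>, which the place \<open>(0, d)\<close> yields in any case\<close>
  have incl: "{ereal (real j - real i) | i j. S (Suc i) j \<noteq> 0} \<subseteq> {ereal (real j - real i) | i j. S' (Suc i) j \<noteq> 0}"
    if S: "\<And>i j. j \<noteq> i + d \<Longrightarrow> S' (Suc i) j = S (Suc i) j" and S': "S' (Suc 0) d \<noteq> 0"
    for S S' :: "nat \<Rightarrow> nat \<Rightarrow> nat"
  proof
    fix x assume "x \<in> {ereal (real j - real i) | i j. S (Suc i) j \<noteq> 0}"
    then obtain i j where x: "x = ereal (real j - real i)" and ij: "S (Suc i) j \<noteq> 0" by blast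
    have "\<exists>i' j'. x = ereal (real j' - real i') \<and> S' (Suc i') j' \<noteq> 0"
    proof (cases "j = i + d")
      case True
      then have "x = ereal (real d - real 0) \<and> S' (Suc 0) d \<noteq> 0" using x S' by simp
      then show ?thesis by blast
    next
      case False
      then have "x = ereal (real j - real i) \<and> S' (Suc i) j \<noteq> 0" using x S ij by simp
      then show ?thesis by blast
    qed
    then show "x \<in> {ereal (real j - real i) | i j. S' (Suc i) j \<noteq> 0}" by blast
  qed
  have "{ereal (real j - real i) | i j. R (Suc i) j \<noteq> 0} = {ereal (real j - real i) | i j. R' (Suc i) j \<noteq> 0}"
    using incl[of R' R] incl[of R R'] eq gens by (intro equalityI) simp_all
  then show ?thesis
    unfolding regularity_eq_resolution[OF R] regularity_eq_resolution[OF R'] by (simp only:)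
qed

end
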